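(* Let $f:\mathbb{R}^n\to\mathbb{R}^n$ be continuously differentiable, let $m\in\mathbb{R}$, and let $\phi$ be a denominator function. Consider the system $dy/dt=f(y)$ and the NSFD scheme $$\frac{y_{k+1}-y_k}{\phi(\Delta t)}=f(y_k)+m y_k-m y_{k+1},\qquad\text{equivalently}\qquad y_{k+1}=y_k+\frac{\phi(\Delta t)}{1+m\phi(\Delta t)}f(y_k).$$ Then the following hold. 1. (Positivity) Suppose there is a real number $\alpha$ such that $f(y)+\alpha y\ge 0$ for all $y\in\mathbb{R}^n$ with $y\ge 0$. If $m\ge m_P:=\max\{\alpha,0\}$, then the scheme is dynamically consistent with the positivity of the system: for every $\Delta t>0$, $y_0\ge 0$ implies $y_k\ge 0$ for all $k\in\mathbb{N}$. 2. (Local asymptotic stability) Suppose the set of equilibria of the system is finite, all equilibria are hyperbolic, and the set $\mathcal{E}_C^S$ of asymptotically stable equilibria is nonempty. Let $$\mathcal{F}=\bigcup_{y^*\in\mathcal{E}_C^S}\sigma(J_C(y^* )),\qquad m_S=\max_{\lambda\in\mathcal{F}}\left\{-\frac{|\lambda|^2}{2\,\mathrm{Re}\,\lambda}\right\}.$$ If $m\ge m_S$, then the scheme is dynamically consistent with the local asymptotic stability of the system, for every $\Delta t>0$. 3. (Direct conservation law) If the system satisfies a direct conservation law, then for all values of $m$ the scheme is dynamically consistent with it: for every $\Delta t>0$ with $1+m\phi(\Delta t)\ne 0$, every solution $(y_k)$ of the scheme satisfies $\sum_{i=1}^n y_{i,k+1}=\sum_{i=1}^n y_{i,k}$ for all $k\ge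 0$. 4. (Generalized conservation law) Suppose the system satisfies a generalized conservation law with constants $a_1,b_1>0$. The scheme is dynamically consistent with it if one of the following holds: (a) $m\ge m_{GCL}:=b_1$ (for every $\Delta t>0$); or (b) $\phi(\Delta t)=\phi_E(\Delta t):=\dfrac{\phi^*(\Delta t)}{1-m\phi^*(\Delta t)}$, where $\phi^*(\Delta t)=\dfrac{1-e^{-b_1\Delta t}}{b_1}$ (for every $\Delta t>0$ at which $\phi_E$ is defined, i.e. $1-m\phi^*(\Delta t)\neq 0$; in this case positivity of $\phi$ is not required).
   Context: Inequalities between vectors are componentwise. A denominator function is a function $\phi:(0,\infty)\to(0,\infty)$ of the step size $\Delta t$ with $\phi(\Delta t)=\Delta t+\mathcal{O}(\Delta t^2)$ as $\Delta t\to 0$. An equilibrium of $dy/dt=f(y)$ is a point $y^*$ with $f(y^* )=0$; $J_C(y^* )$ is the Jacobian matrix of $f$ at $y^*$, $\sigma(\cdot)$ denotes the set of (complex) eigenvalues, and $y^*$ is hyperbolic if no eigenvalue of $J_C(y^* )$ lies on the imaginary axis. An equilibrium of a discrete system $y_{k+1}=g(y_k)$ is a point with $g(y^* )=y^*$. Stable, unstable (not stable) and (locally) asymptotically stable (stable and attracting all initial data in some neighborhood) have the usual Lyapunov meanings for the continuous and the discrete system. The scheme is dynamically consistent with the local asymptotic stability of the system for the step size $\Delta t$ if every asymptotically stable equilibrium of the system is an asymptotically stable equilibrium of the scheme, and every unstable equilibrium of the system is an unstable equilibrium of the scheme. Write $P_T=y_1+\dots+y_n$. The system satisfies a direct conservation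 law if $dP_T/dt=0$ along every solution (with arbitrary initial value in $\mathbb{R}^n$). It satisfies a generalized conservation law with constants $a_1,b_1>0$ if $dP_T/dt=a_1-b_1P_T$ along every solution; then $P_T(t)$ converges monotonically to $a_1/b_1$ as $t\to\infty$ for solutions that exist for all $t\ge0$. For a solution $(y_k)$ of the scheme put $P_{T,k}=\sum_{i=1}^n y_{i,k}$, where $y_{i,k}$ is the $i$-th component of $y_k$. The scheme is dynamically consistent with the generalized conservation law (for a given step size) if for every solution of the scheme the sequence $(P_{T,k})_k$ converges monotonically to $a_1/b_1$ as $k\to\infty$. *)

theory Defs
  imports "HOL-Analysis.Analysis" "HOL-Library.Landau_Symbols"
begin

section \<open>The continuous system\<close>

definition C1_map :: "(real^'n \<Rightarrow> real^'n) \<Rightarrow> bool" where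
  "C1_map f \<longleftrightarrow> f differentiable_on UNIV \<and> continuous_on UNIV (\<lambda>y. jacobian f (at y))"

definition ode_solution_on :: "(real^'n \<Rightarrow> real^'n) \<Rightarrow> real set \<Rightarrow> (real \<Rightarrow> real^'n) \<Rightarrow> bool" where
  "ode_solution_on f I y \<longleftrightarrow> (\<forall>t\<in>I. (y has_vector_derivative f (y t)) (at t within I))"

definition ode_equilibrium :: "(real^'n \<Rightarrow> real^'n) \<Rightarrow> real^'n \<Rightarrow> bool" where
  "ode_equilibrium f ys \<longleftrightarrow> f ys = 0"

text \<open>Solutions need not be global, so stability quantifies over solutions on all intervals
  \<open>[0,T)\<close>; a solution that blows up in finite time after starting close to \<open>ys\<close> thus violates
  stability. For locally Lipschitz \<open>f\<close>, the bound implies that the maximal solutions starting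
  close to \<open>ys\<close> exist for all \<open>t \<ge> 0\<close>.\<close>

definition ode_stable :: "(real^'n \<Rightarrow> real^'n) \<Rightarrow> real^'n \<Rightarrow> bool" where
  "ode_stable f ys \<longleftrightarrow>
     (\<forall>\<epsilon>>0. \<exists>\<delta>>0. \<forall>T>0. \<forall>y. ode_solution_on f {0..<T} y \<and> dist (y 0) ys < \<delta>
        \<longrightarrow> (\<forall>t\<in>{0..<T}. dist (y t) ys < \<epsilon>))"

definition ode_attractive :: "(real^'n \<Rightarrow> real^'n) \<Rightarrow> real^'n \<Rightarrow> bool" where
  "ode_attractive f ys \<longleftrightarrow>
     (\<exists>\<delta>>0. \<forall>y0. dist y0 ys < \<delta> \<longrightarrow>
        (\<exists>y. ode_solution_on f {0..} y \<and> y 0 = y0) \<and>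
        (\<forall>y. ode_solution_on f {0..} y \<and> y 0 = y0 \<longrightarrow> (y \<longlongrightarrow> ys) at_top))"

definition ode_asymptotically_stable_equilibrium ::
    "(real^'n \<Rightarrow> real^'n) \<Rightarrow> real^'n \<Rightarrow> bool" where
  "ode_asymptotically_stable_equilibrium f ys \<longleftrightarrow>
     ode_equilibrium f ys \<and> ode_stable f ys \<and> ode_attractive f ys"

definition ode_unstable_equilibrium :: "(real^'n \<Rightarrow> real^'n) \<Rightarrow> real^'n \<Rightarrow> bool" where
  "ode_unstable_equilibrium f ys \<longleftrightarrow> ode_equilibrium f ys \<and> \<not> ode_stable f ys"

definition complex_spectrum :: "real^'n^'n \<Rightarrow> complex set" where
  "complex_spectrum A =
     {\<mu>. \<exists>v::complex^'n. v \<noteq> 0 \<and> map_matrix complex_of_real A *v v = \<mu> *s v}"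

definition hyperbolic :: "(real^'n \<Rightarrow> real^'n) \<Rightarrow> real^'n \<Rightarrow> bool" where
  "hyperbolic f ys \<longleftrightarrow> (\<forall>\<mu>\<in>complex_spectrum (jacobian f (at ys)). Re \<mu> \<noteq> 0)"

definition stable_spectra :: "(real^'n \<Rightarrow> real^'n) \<Rightarrow> complex set" where
  "stable_spectra f =
     (\<Union>ys\<in>{ys. ode_asymptotically_stable_equilibrium f ys}. complex_spectrum (jacobian f (at ys)))"

definition m_S :: "(real^'n \<Rightarrow> real^'n) \<Rightarrow> real" where
  "m_S f = Max ((\<lambda>\<mu>. - ((cmod \<mu>)\<^sup>2 / (2 * Re \<mu>))) ` stable_spectra f)"

definition component_sum :: "real^'n \<Rightarrow> real" where
  "component_sum y = (\<Sum>i\<in>UNIV. y $ i)"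

definition direct_conservation_law :: "(real^'n \<Rightarrow> real^'n) \<Rightarrow> bool" where
  "direct_conservation_law f \<longleftrightarrow>
     (\<forall>T>0. \<forall>y. ode_solution_on f {0..<T} y \<longrightarrow>
        (\<forall>t\<in>{0..<T}. ((\<lambda>s. component_sum (y s)) has_real_derivative 0) (at t within {0..<T})))"

definition generalized_conservation_law :: "(real^'n \<Rightarrow> real^'n) \<Rightarrow> real \<Rightarrow> real \<Rightarrow> bool" where
  "generalized_conservation_law f a b \<longleftrightarrow>
     (\<forall>T>0. \<forall>y. ode_solution_on f {0..<T} y \<longrightarrow>
        (\<forall>t\<in>{0..<T}. ((\<lambda>s. component_sum (y s)) has_real_derivative (a - b * component_sum (y t)))
           (at t within {0..<T})))"

section \<open>Discrete systems\<close>

definition map_equilibrium :: "(real^'n \<Rightarrow> real^'n) \<Rightarrow> real^'n \<Rightarrow> bool" where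
  "map_equilibrium g ys \<longleftrightarrow> g ys = ys"

definition map_stable :: "(real^'n \<Rightarrow> real^'n) \<Rightarrow> real^'n \<Rightarrow> bool" where
  "map_stable g ys \<longleftrightarrow>
     (\<forall>\<epsilon>>0. \<exists>\<delta>>0. \<forall>y0. dist y0 ys < \<delta> \<longrightarrow> (\<forall>k. dist ((g ^^ k) y0) ys < \<epsilon>))"

definition map_attractive :: "(real^'n \<Rightarrow> real^'n) \<Rightarrow> real^'n \<Rightarrow> bool" where
  "map_attractive g ys \<longleftrightarrow>
     (\<exists>\<delta>>0. \<forall>y0. dist y0 ys < \<delta> \<longrightarrow> (\<lambda>k. (g ^^ k) y0) \<longlonglongrightarrow> ys)"

definition map_asymptotically_stable_equilibrium ::
    "(real^'n \<Rightarrow> real^'n) \<Rightarrow> real^'n \<Rightarrow> bool" where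
  "map_asymptotically_stable_equilibrium g ys \<longleftrightarrow>
     map_equilibrium g ys \<and> map_stable g ys \<and> map_attractive g ys"

definition map_unstable_equilibrium :: "(real^'n \<Rightarrow> real^'n) \<Rightarrow> real^'n \<Rightarrow> bool" where
  "map_unstable_equilibrium g ys \<longleftrightarrow> map_equilibrium g ys \<and> \<not> map_stable g ys"

section \<open>The NSFD scheme\<close>

definition denominator_function :: "(real \<Rightarrow> real) \<Rightarrow> bool" where
  "denominator_function \<phi> \<longleftrightarrow>
     (\<forall>t>0. \<phi> t > 0) \<and> (\<lambda>t. \<phi> t - t) \<in> O[at_right 0](\<lambda>t. t\<^sup>2)"

text \<open>Below, \<open>h\<close> stands for the value \<open>\<phi> \<Delta>t\<close> of the denominator function.\<close>

definition nsfd_solution ::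
    "(real^'n \<Rightarrow> real^'n) \<Rightarrow> real \<Rightarrow> real \<Rightarrow> (nat \<Rightarrow> real^'n) \<Rightarrow> bool" where
  "nsfd_solution f m h y \<longleftrightarrow>
     (\<forall>k. (y (Suc k) - y k) /\<^sub>R h = f (y k) + m *\<^sub>R y k - m *\<^sub>R y (Suc k))"

definition nsfd_map :: "(real^'n \<Rightarrow> real^'n) \<Rightarrow> real \<Rightarrow> real \<Rightarrow> real^'n \<Rightarrow> real^'n" where
  "nsfd_map f m h y = y + (h / (1 + m * h)) *\<^sub>R f y"

lemma nsfd_solution_iff_map:
  assumes "h \<noteq> 0" "1 + m * h \<noteq> 0"
  shows "nsfd_solution f m h y \<longleftrightarrow> (\<forall>k. y (Suc k) = nsfd_map f m h (y k))"
proof -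
  have key: "inverse h * (u - v) = w + m * v - m * u \<longleftrightarrow> u = v + h / (1 + m * h) * w" for u v w :: real
  proof -
    have "inverse h * (u - v) = w + m * v - m * u \<longleftrightarrow> (u - v) * (1 + m * h) = h * w"
      using assms(1) by (auto simp: field_simps)
    also have "\<dots> \<longleftrightarrow> u - v = h * w / (1 + m * h)"
      using assms(2) by (simp add: eq_divide_eq)
    also have "\<dots> \<longleftrightarrow> u = v + h / (1 + m * h) * w"
      by auto
    finally show ?thesis .
  qed
  show ?thesis
    by (simp add: nsfd_solution_def nsfd_map_def vec_eq_iff key del: times_divide_eq_left)
qed

definition consistent_positivity :: "(real^'n \<Rightarrow> real^'n) \<Rightarrow> real \<Rightarrow> real \<Rightarrow> bool" where
  "consistent_positivity f m h \<longleftrightarrow>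
     (\<forall>y. nsfd_solution f m h y \<and> 0 \<le> y 0 \<longrightarrow> (\<forall>k. 0 \<le> y k))"

definition consistent_local_asymptotic_stability ::
    "(real^'n \<Rightarrow> real^'n) \<Rightarrow> real \<Rightarrow> real \<Rightarrow> bool" where
  "consistent_local_asymptotic_stability f m h \<longleftrightarrow>
     (\<forall>ys. ode_asymptotically_stable_equilibrium f ys \<longrightarrow>
        map_asymptotically_stable_equilibrium (nsfd_map f m h) ys) \<and>
     (\<forall>ys. ode_unstable_equilibrium f ys \<longrightarrow>
        map_unstable_equilibrium (nsfd_map f m h) ys)"

definition consistent_direct_conservation ::
    "(real^'n \<Rightarrow> real^'n) \<Rightarrow> real \<Rightarrow> real \<Rightarrow> bool" where
  "consistent_direct_conservation f m h \<longleftrightarrow>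
     (\<forall>y. nsfd_solution f m h y \<longrightarrow> (\<forall>k. component_sum (y (Suc k)) = component_sum (y k)))"

definition consistent_generalized_conservation ::
    "(real^'n \<Rightarrow> real^'n) \<Rightarrow> real \<Rightarrow> real \<Rightarrow> real \<Rightarrow> real \<Rightarrow> bool" where
  "consistent_generalized_conservation f a b m h \<longleftrightarrow>
     (\<forall>y. nsfd_solution f m h y \<longrightarrow>
        monoseq (\<lambda>k. component_sum (y k)) \<and> (\<lambda>k. component_sum (y k)) \<longlonglongrightarrow> a / b)"

definition phi_star :: "real \<Rightarrow> real \<Rightarrow> real" where
  "phi_star b t = (1 - exp (- b * t)) / b"

definition phi_E :: "real \<Rightarrow> real \<Rightarrow> real \<Rightarrow> real" where
  "phi_E m b t = phi_star b t / (1 - m * phi_star b t)"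

end

(* Near an equilibrium everything is read off a quadratic form. Over the complex numbers the
   Jacobian is triangularizable with arbitrarily small off-diagonal entries, so in suitable
   coordinates z both the flow and the scheme are diagonal up to a small relative error, with
   eigenvalues l i and 1 + sigma * l i respectively, where sigma = phi / (1 + m * phi). Choosing signs
   s i = 1 on the expanding and s i = -1 on the contracting directions, the form
   V z = sum s i * |z i|^2 increases along every solution that stays close to the equilibrium.
   If all signs are -1 this is Lyapunov's argument for stability; otherwise a real vector with
   V > 0 leads to instability. The bound m >= m_S is exactly what makes |1 + sigma * mu| < 1 for every
   mu in the spectrum of a stable equilibrium, because sigma < 1 / m.

   For the conservation laws, a solution exists through every point by Picard iteration, so the
   law forces sum f(y) = 0, respectively sum f(y) = a - b * sum y, at every y. The component sum of
   the scheme then satisfies an affine recursion with factor 1 - sigma * b in (0, 1). *)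

theory Submission
  imports Defs "HOL-Computational_Algebra.Fundamental_Theorem_Algebra"
begin

section \<open>Approximate diagonalization over the complex numbers\<close>

text \<open>The Jacobian is real but its eigenvectors need not be, whereas only real initial values
  are available. So the coordinates are complex-valued but real-linear, and the delicate point of
  instability is to find a real vector with V > 0: an eigenvector and its conjugate have to be used
  together. A relative error of size \<epsilon> changes V, or its derivative, by at most a constant
  times \<epsilon> * |z|^2, which a spectral gap absorbs: Re (l i) stays away from 0 for the flow,
  |1 + sigma * l i| from a threshold for the scheme. Since \<epsilon> is chosen from this gap, the
  list l has to be fixed before \<epsilon>. As m_S only looks at the stable equilibria, the
  multipliers of the scheme at an unstable one may lie on the unit circle; there the threshold is
  placed strictly above 1. The formula for m_S comes from |1 + sigma * \<mu>|^2 = 1 + sigma * (2 Re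
  \<mu> + sigma * |\<mu>|^2): this is below 1 as long as sigma < - 2 Re \<mu> / |\<mu>|^2, and m_S
  is the largest reciprocal of these bounds.\<close>

definition eigenvalues :: "complex^'n^'n \<Rightarrow> complex set" where
  "eigenvalues A = {\<mu>. \<exists>v. v \<noteq> 0 \<and> A *v v = \<mu> *s v}"

text \<open>This is p(A) v, computed by Horner's rule on vectors, so that powers of matrices do not
  occur.\<close>

definition poly_act :: "complex^'n^'n \<Rightarrow> complex^'n \<Rightarrow> complex poly \<Rightarrow> complex^'n" where
  "poly_act A v p = fold_coeffs (\<lambda>a x. a *s v + A *v x) p 0"

lemma poly_act_0 [simp]: "poly_act A v 0 = 0"
  by (simp add: poly_act_def)

lemma poly_act_pCons [simp]: "poly_act A v (pCons a p) = a *s v + A *v poly_act A v p"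
  by (cases "p = 0 \<and> a = 0") (auto simp: poly_act_def)

lemma poly_act_add: "poly_act A v (p + q) = poly_act A v p + poly_act A v q"
  by (induction p q rule: poly_induct2) (auto simp: algebra_simps)

lemma poly_act_smult: "poly_act A v (smult a p) = a *s poly_act A v p"
  by (induction p) (auto simp: algebra_simps vector_scalar_commute)

lemma poly_act_diff: "poly_act A v (p - q) = poly_act A v p - poly_act A v q"
  using poly_act_add[of A v "p - q" q] by simp

lemma poly_act_sum: "poly_act A v (sum p S) = (\<Sum>i\<in>S. poly_act A v (p i))"
  by (induction S rule: infinite_finite_induct) (auto simp: poly_act_add)

lemma poly_act_linear_factor:
  "poly_act A v ([:- r, 1:] * q) = A *v poly_act A v q - r *s poly_act A v q"
  by (simp add: poly_act_diff poly_act_smult)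

text \<open>The vectors A^i v with i up to the dimension are one too many to be independent, and a
  dependence among them is the polynomial. It may depend on v.\<close>

lemma ex_annihilating_poly:
  fixes A :: "complex^'n^'n"
  shows "\<exists>p. p \<noteq> 0 \<and> poly_act A v p = 0"
proof -
  define w where "w i = poly_act A v (monom 1 i)" for i :: nat
  let ?I = "{..CARD('n)}"
  show ?thesis
  \<comment> \<open>\<open>vec.dependent\<close> is a property of sets and does not see repetitions,
    so two equal vectors have to give the polynomial directly.\<close>
  proof (cases "inj_on w ?I")
    case False
    then obtain i j where "i \<noteq> j" "w i = w j"
      by (auto simp: inj_on_def)
    then show ?thesis
      by (intro exI[of _ "monom 1 i - monom 1 j"]) (simp add: poly_act_diff w_def monom_eq_iff')
  next
    case True
    have "vec.dependent (w ` ?I)"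
    proof (rule ccontr)
      assume "vec.independent (w ` ?I)"
      then have "card (w ` ?I) = vec.dim (w ` ?I)"
        by (simp add: vec.dim_eq_card_independent)
      also have "\<dots> \<le> CARD('n)"
        by (rule dim_subset_UNIV_cart_gen)
      finally show False
        using True by (simp add: card_image)
    qed
    then obtain u where u: "\<exists>x\<in>w ` ?I. u x \<noteq> 0" "(\<Sum>x\<in>w ` ?I. u x *s x) = 0"
      by (auto simp: vec.dependent_finite)
    define p where "p = (\<Sum>i\<in>?I. smult (u (w i)) (monom 1 i))"
    have "coeff p i = u (w i)" if "i \<in> ?I" for i
      using that by (simp add: p_def coeff_sum if_distrib cong: if_cong)
    then have "p \<noteq> 0"
      using u(1) by (metis coeff_0 imageE)
    moreover have "poly_act A v p = (\<Sum>i\<in>?I. u (w i) *s w i)"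
      by (simp add: p_def poly_act_sum poly_act_smult w_def del: smult_monom)
    then have "poly_act A v p = 0"
      using u(2) by (simp add: sum.reindex[OF True])
    ultimately show ?thesis
      by blast
  qed
qed

lemma mat_mult_vec: "mat r *v x = (r::'a::semiring_1) *s x"
  by (simp add: vec_eq_iff matrix_vector_mult_def mat_def if_distrib if_distribR cong: if_cong)

text \<open>An eigenvector of the map induced on the quotient by W. Take p of least degree with p(A)
  v in W for some v outside W, and split off a root r. The cofactor q has smaller degree, so w =
  q(A) v lies outside W, while (A - r) w = p(A) v lies in W.\<close>

lemma ex_eigenvector_mod_subspace:
  fixes A :: "complex^'n^'n"
  assumes W: "vec.subspace W" and inv: "\<And>x. x \<in> W \<Longrightarrow> A *v x \<in> W" and ne: "W \<noteq> UNIV"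
  obtains r w where "w \<notin> W" "A *v w - r *s w \<in> W" "r \<in> eigenvalues A"
proof -
  obtain v where v: "v \<notin> W"
    using ne by blast
  define P where "P p \<longleftrightarrow> p \<noteq> 0 \<and> poly_act A v p \<in> W" for p
  obtain p0 where "P p0"
    using ex_annihilating_poly[of A v] vec.subspace_0[OF W] unfolding P_def by metis
  then obtain p where p: "P p" and min: "\<And>q. P q \<Longrightarrow> degree p \<le> degree q"
    using ex_has_least_nat[of P p0 degree] by blast
  have "degree p \<noteq> 0"
  proof
    assume "degree p = 0"
    then obtain a where a: "p = [:a:]"
      by (rule degree_eq_zeroE)
    then have "a \<noteq> 0" "a *s v \<in> W"
      using p by (auto simp: P_def)
    then have "inverse a *s (a *s v) \<in> W"
      using W vec.subspace_scale by blast
    with \<open>a \<noteq> 0\<close> v show False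
      by simp
  qed
  then obtain r where "poly p r = 0"
    using fundamental_theorem_of_algebra[of p] constant_degree[of p] by auto
  then obtain q where q: "p = [:- r, 1:] * q"
    by (auto simp: poly_eq_0_iff_dvd elim: dvdE)
  then have "q \<noteq> 0"
    using p by (auto simp: P_def)
  have "degree p = Suc (degree q)"
    using \<open>q \<noteq> 0\<close> by (simp add: q degree_mult_eq del: mult_pCons_left)
  define w where "w = poly_act A v q"
  have w: "w \<notin> W"
    using min[of q] \<open>q \<noteq> 0\<close> \<open>degree p = _\<close> by (auto simp: P_def w_def)
  have Aw: "A *v w - r *s w \<in> W"
    using p by (simp add: P_def q w_def poly_act_linear_factor del: mult_pCons_left)
  \<comment> \<open>If \<open>A - r\<close> were injective, it would map \<open>W\<close> onto \<open>W\<close> and hence not send \<open>w\<close> into \<open>W\<close>.\<close>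
  have "r \<in> eigenvalues A"
  proof (rule ccontr)
    assume "r \<notin> eigenvalues A"
    define B where "B = A - mat r"
    have B: "B *v x = A *v x - r *s x" for x
      by (simp add: B_def matrix_vector_mult_diff_rdistrib mat_mult_vec)
    have ker: "x = 0" if "B *v x = 0" for x
      using that \<open>r \<notin> eigenvalues A\<close> by (auto simp: B eigenvalues_def)
    have inj: "inj ((*v) B)"
      by (metis ker matrix_left_invertible_ker matrix_left_invertible_injective)
    have "vec.subspace ((*v) B ` W)"
      using W by (rule vec.subspace_image)
    moreover have "(*v) B ` W \<subseteq> W"
      using inv W by (auto simp: B vec.subspace_diff vec.subspace_scale)
    moreover have "vec.dim ((*v) B ` W) = vec.dim W"
      by (intro vec.dim_image_eq inj_on_subset[OF inj]) auto
    ultimately have "(*v) B ` W = W"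
      using W by (intro vec.subspace_dim_equal) auto
    moreover have "B *v w \<in> W"
      using Aw by (simp add: B)
    ultimately show False
      using w inj by (metis (no_types, lifting) imageE injD)
  qed
  with w Aw show thesis
    using that by blast
qed

section \<open>The spectrum of the transpose\<close>

lemma eigenvalues_iff_singular: "\<mu> \<in> eigenvalues A \<longleftrightarrow> \<not> invertible (A - mat \<mu>)"
proof -
  have "(A - mat \<mu>) *v x = A *v x - \<mu> *s x" for x
    by (simp add: matrix_vector_mult_diff_rdistrib mat_mult_vec)
  then show ?thesis
    unfolding eigenvalues_def invertible_left_inverse matrix_left_invertible_ker by auto
qed

text \<open>Singularity of A - \<mu> survives transposition. This carries the spectrum over to the
  transpose, to which the triangular chain will be applied.\<close>

lemma eigenvalues_transpose:
  fixes A :: "complex^'n^'n"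
  shows "eigenvalues (transpose A) = eigenvalues A"
proof -
  have *: "transpose A - mat \<mu> = transpose (A - mat \<mu>)" for \<mu>
    by (simp add: vec_eq_iff transpose_def mat_def)
  have "invertible (transpose B) \<longleftrightarrow> invertible B" for B :: "complex^'n^'n"
    unfolding invertible_left_inverse[of "transpose B"] invertible_right_inverse[of B]
    by (rule left_invertible_transpose)
  then show ?thesis
    by (auto simp: eigenvalues_iff_singular *)
qed

section \<open>Invariant flags and triangularization\<close>

lemma span_image_lessThan:
  fixes c :: "nat \<Rightarrow> complex^'n"
  assumes "x \<in> vec.span (c ` {..<k})"
  shows "\<exists>a. x = (\<Sum>j<k. a j *s c j)"
  using assms
proof (induction k arbitrary: x)
  case (Suc k)
  then obtain b where "x - b *s c k \<in> vec.span (c ` {..<k})"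
    by (auto simp: lessThan_Suc vec.span_insert)
  with Suc.IH obtain a where "x - b *s c k = (\<Sum>j<k. a j *s c j)"
    by blast
  then have "x = (\<Sum>j<Suc k. (a(k := b)) j *s c j)"
    by (simp add: algebra_simps)
  then show ?case
    by blast
qed auto

lemma dim_image_lessThan:
  fixes c :: "nat \<Rightarrow> complex^'n"
  assumes "\<forall>i<k. c i \<notin> vec.span (c ` {..<i})"
  shows "vec.dim (c ` {..<k}) = k"
  using assms by (induction k) (auto simp: lessThan_Suc vec.dim_insert)

text \<open>Schur triangularization without orthogonality: the span of the vectors found so far is
  invariant and, while k is below the dimension, proper. An eigenvector modulo this span is the next
  vector of the chain.\<close>

lemma ex_triangular_chain:
  fixes A :: "complex^'n^'n"
  assumes "k \<le> CARD('n)"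
  shows "\<exists>c l a. \<forall>i<k. c i \<notin> vec.span (c ` {..<i}) \<and> l i \<in> eigenvalues A \<and>
           A *v c i = l i *s c i + (\<Sum>j<i. a i j *s c j)"
  using assms
proof (induction k)
  case (Suc k)
  then obtain c l a where c: "\<forall>i<k. c i \<notin> vec.span (c ` {..<i}) \<and> l i \<in> eigenvalues A \<and>
           A *v c i = l i *s c i + (\<Sum>j<i. a i j *s c j)"
    by auto
  define W where "W = vec.span (c ` {..<k})"
  have sub: "vec.subspace W"
    by (simp add: W_def)
  have inW: "c i \<in> W" if "i < k" for i
    using that by (auto simp: W_def intro: vec.span_base)
  have "A *v x \<in> W" if "x \<in> W" for x
  proof -
    obtain b where x: "x = (\<Sum>j<k. b j *s c j)"
      using span_image_lessThan \<open>x \<in> W\<close> unfolding W_def by blast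
    have "A *v c j \<in> W" if "j < k" for j
      using c that sub inW by (auto intro!: vec.subspace_add vec.subspace_scale vec.subspace_sum)
    then show ?thesis
      using sub by (auto simp: x vec.sum vec.scale intro!: vec.subspace_sum vec.subspace_scale)
  qed
  moreover have "W \<noteq> UNIV"
  proof
    assume "W = UNIV"
    then have "vec.dim (UNIV :: (complex^'n) set) = k"
      using dim_image_lessThan[of k c] c unfolding W_def by (metis vec.dim_span)
    then show False
      using Suc.prems by (simp add: card_cart_basis)
  qed
  ultimately obtain r w where w: "w \<notin> W" "A *v w - r *s w \<in> W" "r \<in> eigenvalues A"
    using ex_eigenvector_mod_subspace[OF sub, of A] by metis
  then obtain b where b: "A *v w - r *s w = (\<Sum>j<k. b j *s c j)"
    using span_image_lessThan unfolding W_def by blast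
  define c' where "c' = c(k := w)"
  have c': "c' i = c i" if "i < k" for i
    using that by (simp add: c'_def)
  have c'k: "c' k = w"
    by (simp add: c'_def)
  have img: "c' ` {..<i} = c ` {..<i}" if "i \<le> k" for i
    using that c' by (intro image_cong) auto
  have comb: "(\<Sum>j<i. d j *s c' j) = (\<Sum>j<i. d j *s c j)" if "i \<le> k" for i d
    using that c' by (intro sum.cong) auto
  have "c' i \<notin> vec.span (c' ` {..<i}) \<and> (l(k := r)) i \<in> eigenvalues A \<and>
      A *v c' i = (l(k := r)) i *s c' i + (\<Sum>j<i. (a(k := b)) i j *s c' j)" if "i < Suc k" for i
  proof (cases "i = k")
    case True
    then show ?thesis
      using w b by (simp add: img comb c'k W_def algebra_simps)
  next
    case False
    then have "i < k"
      using that by simp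
    then show ?thesis
      using c by (simp add: img comb c')
  qed
  then show ?case
    by blast
qed auto

lemma norm_vec_le_sum: "norm x \<le> (\<Sum>i\<in>UNIV. norm (x $ i))"
  by (simp add: norm_vec_def L2_set_le_sum)

text \<open>The chain is taken for the transpose of A, so that its vectors are read as linear
  functionals, that is, as coordinates: A multiplies the i-th coordinate by l i and adds a
  combination of earlier ones. The rows of M are rescaled functionals, and no inverse matrix is
  needed. The list l does not depend on \<epsilon>.\<close>

lemma almost_diagonalization:
  fixes A :: "complex^'n^'n"
  obtains l :: "'n \<Rightarrow> complex" where "range l = eigenvalues A"
    "\<And>\<epsilon>. \<epsilon> > 0 \<Longrightarrow> \<exists>M :: complex^'n^'n. (\<forall>v. M *v v = 0 \<longrightarrow> v = 0) \<and>
       (\<forall>v. norm (M *v (A *v v) - (\<chi> i. l i * (M *v v) $ i)) \<le> \<epsilon> * norm (M *v v))"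
proof -
  define N where "N = CARD('n)"
  obtain c l a where c: "\<forall>i<N. c i \<notin> vec.span (c ` {..<i}) \<and> l i \<in> eigenvalues A \<and>
      transpose A *v c i = l i *s c i + (\<Sum>j<i. a i j *s c j)"
    using ex_triangular_chain[of N "transpose A"] by (auto simp: N_def eigenvalues_transpose)
  \<comment> \<open>Bilinear, without conjugation, so that A moves across as its transpose and not
    as its adjoint.\<close>
  define dot where "dot x y = (\<Sum>i\<in>UNIV. x $ i * y $ i)" for x y :: "complex^'n"
  have dot_add: "dot (x + y) z = dot x z + dot y z" for x y z
    by (simp add: dot_def algebra_simps sum.distrib)
  have dot_scale: "dot (b *s x) z = b * dot x z" for b x z
    by (simp add: dot_def algebra_simps sum_distrib_left)
  have dot_sum: "dot (\<Sum>j\<in>S. g j) z = (\<Sum>j\<in>S. dot (g j) z)" if "finite S" for S z and g :: "nat \<Rightarrow> _"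
    using that by (induction S) (auto simp: dot_add, simp add: dot_def)
  have dot_transpose: "dot x (A *v y) = dot (transpose A *v x) y" for x y
    unfolding dot_def matrix_vector_mult_def transpose_def
    by (simp add: sum_distrib_left sum_distrib_right) (subst sum.swap, simp add: algebra_simps)
  have dotA: "dot (c i) (A *v v) = l i * dot (c i) v + (\<Sum>j<i. a i j * dot (c j) v)" if "i < N" for i v
    using c that by (simp add: dot_transpose dot_add dot_scale dot_sum)
  obtain r :: "'n \<Rightarrow> nat" where r: "bij_betw r UNIV {..<N}"
    using ex_bij_betw_finite_nat[of "UNIV :: 'n set"] by (auto simp: N_def atLeast0LessThan)
  then have rN: "r i < N" for i
    by (auto simp: bij_betw_def)
  have "vec.dim (c ` {..<N}) = CARD('n)"
    using c by (subst dim_image_lessThan) (auto simp: N_def)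
  then have span: "vec.span (c ` {..<N}) = UNIV"
    by (metis vec.dim_UNIV vec.dim_eq_full vec.dimension_def vec_dim_card)
  define K where "K = (\<Sum>i<N. \<Sum>j<N. cmod (a i j))"
  have aK: "cmod (a i j) \<le> K" if "i < N" "j < N" for i j
  proof -
    have "cmod (a i j) \<le> (\<Sum>j<N. cmod (a i j))"
      using that by (intro member_le_sum) auto
    also have "\<dots> \<le> K"
      unfolding K_def using that by (intro member_le_sum[of i _ "\<lambda>i. \<Sum>j<N. cmod (a i j)"]) (auto intro: sum_nonneg)
    finally show ?thesis .
  qed
  have "K \<ge> 0"
    by (simp add: K_def sum_nonneg)
  have approx: "\<exists>M :: complex^'n^'n. (\<forall>v. M *v v = 0 \<longrightarrow> v = 0) \<and>
      (\<forall>v. norm (M *v (A *v v) - (\<chi> i. l (r i) * (M *v v) $ i)) \<le> \<epsilon> * norm (M *v v))"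
    if "\<epsilon> > 0" for \<epsilon>
  proof -
    \<comment> \<open>One factor N counts the terms of a row, the other one the coordinates in
      \<open>norm_vec_le_sum\<close>. The summand 1 keeps the denominator positive, and d \<le> 1
      makes the powers of d decrease.\<close>
    define d where "d = min 1 (\<epsilon> / (N * (N * K) + 1))"
    have d: "0 < d" "d \<le> 1"
      using \<open>K \<ge> 0\<close> \<open>\<epsilon> > 0\<close> by (auto simp: d_def add_nonneg_pos)
    have "d * (N * (N * K) + 1) \<le> \<epsilon>"
      using \<open>K \<ge> 0\<close> by (simp add: d_def pos_le_divide_eq[symmetric] add_nonneg_pos)
    with d have d\<epsilon>: "d * (N * (N * K)) \<le> \<epsilon>"
      by (simp add: algebra_simps)
    \<comment> \<open>Scaling the \<open>k\<close>-th functional by \<open>d ^ k\<close> multiplies the off-diagonal entries by at most \<open>d\<close>.\<close>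
    define M :: "complex^'n^'n" where "M = (\<chi> i. of_real (d ^ r i) *s c (r i))"
    have M: "(M *v v) $ i = of_real (d ^ r i) * dot (c (r i)) v" for v i
      by (simp add: M_def matrix_vector_mult_def dot_def sum_distrib_left algebra_simps)
    have bnd: "d ^ j * cmod (dot (c j) v) \<le> norm (M *v v)" if "j < N" for j v
    proof -
      have "j \<in> range r"
        using r that by (simp add: bij_betw_imp_surj_on)
      then obtain i where "r i = j"
        by auto
      then have "d ^ j * cmod (dot (c j) v) = cmod ((M *v v) $ i)"
        using d by (simp add: M norm_mult norm_power)
      then show ?thesis
        by (simp add: Finite_Cartesian_Product.norm_nth_le)
    qed
    have "v = 0" if "M *v v = 0" for v
    proof -
      have "dot (c j) v = 0" if "j < N" for j
        using bnd[OF that, of v] \<open>M *v v = 0\<close> zero_less_power[OF d(1), of j]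
        by (auto simp: mult_le_0_iff)
      then have "dot x v = 0" for x
        using span_image_lessThan[of x c N] by (auto simp: span dot_sum dot_scale)
      from this[of "axis _ 1"] show ?thesis
        by (simp add: dot_def axis_def vec_eq_iff if_distrib if_distribR cong: if_cong)
    qed
    moreover have "norm (M *v (A *v v) - (\<chi> i. l (r i) * (M *v v) $ i)) \<le> \<epsilon> * norm (M *v v)" for v
    proof -
      let ?E = "M *v (A *v v) - (\<chi> i. l (r i) * (M *v v) $ i)"
      have "cmod (?E $ i) \<le> N * (K * d * norm (M *v v))" for i
      proof -
        have "?E $ i = of_real (d ^ r i) * (\<Sum>j<r i. a (r i) j * dot (c j) v)"
          using rN[of i] by (simp add: M dotA algebra_simps)
        then have "cmod (?E $ i) = d ^ r i * cmod (\<Sum>j<r i. a (r i) j * dot (c j) v)"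
          using d by (simp add: norm_mult norm_power)
        also have "\<dots> \<le> d ^ r i * (\<Sum>j<r i. cmod (a (r i) j) * cmod (dot (c j) v))"
          using d by (intro mult_left_mono order.trans[OF norm_sum]) (auto simp: norm_mult)
        also have "\<dots> = (\<Sum>j<r i. d ^ r i * (cmod (a (r i) j) * cmod (dot (c j) v)))"
          by (simp add: sum_distrib_left)
        also have "\<dots> \<le> (\<Sum>j<r i. K * d * norm (M *v v))"
        proof (rule sum_mono)
          fix j assume "j \<in> {..<r i}"
          then have j: "j < r i" "j < N"
            using rN[of i] by auto
          have "d ^ r i \<le> d ^ Suc j"
            using d j by (intro power_decreasing) auto
          then have "d ^ r i * (cmod (a (r i) j) * cmod (dot (c j) v)) \<le>
              (d * d ^ j) * (K * cmod (dot (c j) v))"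
            using aK[OF rN j(2)] d \<open>K \<ge> 0\<close> by (intro mult_mono) auto
          also have "\<dots> = (K * d) * (d ^ j * cmod (dot (c j) v))"
            by simp
          also have "\<dots> \<le> (K * d) * norm (M *v v)"
            using bnd[OF j(2)] d \<open>K \<ge> 0\<close> by (intro mult_left_mono) auto
          finally show "d ^ r i * (cmod (a (r i) j) * cmod (dot (c j) v)) \<le> K * d * norm (M *v v)" .
        qed
        also have "\<dots> \<le> N * (K * d * norm (M *v v))"
          using rN[of i] d \<open>K \<ge> 0\<close> by (auto intro!: mult_right_mono)
        finally show ?thesis .
      qed
      then have "norm ?E \<le> (\<Sum>i::'n\<in>UNIV. N * (K * d * norm (M *v v)))"
        by (intro order.trans[OF norm_vec_le_sum] sum_mono)
      also have "\<dots> = (d * (N * (N * K))) * norm (M *v v)"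
        by (simp add: N_def)
      also have "\<dots> \<le> \<epsilon> * norm (M *v v)"
        using d\<epsilon> by (intro mult_right_mono) auto
      finally show ?thesis .
    qed
    ultimately show ?thesis
      by blast
  qed
  \<comment> \<open>The chain only says that each l i is an eigenvalue. The converse follows from
    the approximation itself: on an eigenvector of \<mu> the error in coordinate i is exactly \<mu>
    - l i times that coordinate, which is too large if \<mu> keeps a distance g from all l
    i.\<close>
  have "eigenvalues A \<subseteq> range (l \<circ> r)"
  proof
    fix \<mu> assume "\<mu> \<in> eigenvalues A"
    then obtain v where v: "v \<noteq> 0" "A *v v = \<mu> *s v"
      by (auto simp: eigenvalues_def)
    show "\<mu> \<in> range (l \<circ> r)"
    proof (rule ccontr)
      assume *: "\<mu> \<notin> range (l \<circ> r)"
      define g where "g = Min (range (\<lambda>i. cmod (\<mu> - l (r i))))"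
      have g: "g \<le> cmod (\<mu> - l (r i))" for i
        by (simp add: g_def)
      have "g > 0"
        using * by (auto simp: g_def)
      then obtain M :: "complex^'n^'n" where M: "\<And>v. M *v v = 0 \<Longrightarrow> v = 0"
        "\<And>v. norm (M *v (A *v v) - (\<chi> i. l (r i) * (M *v v) $ i)) \<le> g / 2 * norm (M *v v)"
        using approx[of "g / 2"] by auto
      have "norm (g *\<^sub>R (M *v v)) \<le> norm (M *v (A *v v) - (\<chi> i. l (r i) * (M *v v) $ i))"
      proof (rule norm_le_componentwise_cart)
        fix i
        have "(M *v (A *v v) - (\<chi> i. l (r i) * (M *v v) $ i)) $ i = (\<mu> - l (r i)) * (M *v v) $ i"
          by (simp add: v vec.scale algebra_simps)
        then show "norm ((g *\<^sub>R (M *v v)) $ i) \<le> norm ((M *v (A *v v) - (\<chi> i. l (r i) * (M *v v) $ i)) $ i)"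
          using g[of i] \<open>g > 0\<close> by (simp add: norm_mult mult_right_mono)
      qed
      also have "\<dots> \<le> g / 2 * norm (M *v v)"
        by (rule M)
      finally have "M *v v = 0"
        using \<open>g > 0\<close> by simp
      with M v show False
        by blast
    qed
  qed
  then have "range (l \<circ> r) = eigenvalues A"
    using c rN by auto
  then show thesis
    using approx by (intro that[of "l \<circ> r"]) auto
qed

section \<open>Signed quadratic forms\<close>

definition cvec :: "real^'n \<Rightarrow> complex^'n" where
  "cvec x = (\<chi> i. complex_of_real (x $ i))"

lemma cvec_add: "cvec (x + y) = cvec x + cvec y"
  by (simp add: cvec_def vec_eq_iff)

lemma cvec_scaleR: "cvec (c *\<^sub>R x) = c *\<^sub>R cvec x"
  by (simp add: cvec_def vec_eq_iff complex_eq_iff)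

lemma cvec_eq_0_iff [simp]: "cvec x = 0 \<longleftrightarrow> x = 0"
  by (simp add: cvec_def vec_eq_iff)

lemma map_matrix_mult_cvec: "map_matrix complex_of_real A *v cvec x = cvec (A *v x)"
  by (simp add: cvec_def vec_eq_iff matrix_vector_mult_def map_matrix_def)

lemma complex_spectrum_eq: "complex_spectrum A = eigenvalues (map_matrix complex_of_real A)"
  by (simp add: complex_spectrum_def eigenvalues_def)

lemma matrix_vector_mult_scaleR_complex: "M *v (c *\<^sub>R v) = c *\<^sub>R (M *v v)"
  for M :: "complex^'n^'m"
  by (simp add: vec_eq_iff matrix_vector_mult_def scaleR_sum_right)

text \<open>The polar form of V, with the real inner product of complex numbers. Writing it as one
  inner product with a sign-flipped vector lets Cauchy-Schwarz and boundedness be inherited.\<close>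

definition sform :: "('n::finite \<Rightarrow> real) \<Rightarrow> complex^'n \<Rightarrow> complex^'n \<Rightarrow> real" where
  "sform s z w = z \<bullet> (\<chi> i. s i *\<^sub>R (w $ i))"

lemma sform_altdef: "sform s z w = (\<Sum>i\<in>UNIV. s i * (z $ i \<bullet> w $ i))"
  by (simp add: sform_def inner_vec_def)

lemma sform_same: "sform s z z = (\<Sum>i\<in>UNIV. s i * (cmod (z $ i))\<^sup>2)"
  by (simp add: sform_altdef power2_norm_eq_inner)

lemma sform_add_left: "sform s (x + y) z = sform s x z + sform s y z"
  by (simp add: sform_altdef inner_add_left algebra_simps sum.distrib)

lemma sform_add_right: "sform s x (y + z) = sform s x y + sform s x z"
  by (simp add: sform_altdef inner_add_right algebra_simps sum.distrib)

lemma sform_commute: "sform s x y = sform s y x"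
  by (simp add: sform_altdef inner_commute)

lemma sform_scaleR: "sform s (c *\<^sub>R x) (c *\<^sub>R x) = c\<^sup>2 * sform s x x"
  by (simp add: sform_same power_mult_distrib sum_distrib_left algebra_simps)

lemma norm_power2_vec: "(norm z)\<^sup>2 = (\<Sum>i\<in>UNIV. (norm (z $ i))\<^sup>2)" for z :: "'a::real_normed_vector^'n"
  by (simp add: norm_vec_def L2_set_def sum_nonneg)

lemma abs_sform_le:
  assumes "\<And>i. \<bar>s i\<bar> = 1"
  shows "\<bar>sform s z w\<bar> \<le> norm z * norm w"
proof -
  have "norm (\<chi> i. s i *\<^sub>R (w $ i)) \<le> norm w"
    by (rule norm_le_componentwise_cart) (simp add: assms)
  then show ?thesis
    unfolding sform_def
    by (meson Cauchy_Schwarz_ineq2 mult_left_mono norm_ge_zero order.trans)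
qed

lemma bounded_bilinear_sform: "bounded_bilinear (sform s)"
proof -
  have "linear (\<lambda>w :: complex^'a. \<chi> i. s i *\<^sub>R (w $ i))"
    by (auto simp: linear_iff vec_eq_iff algebra_simps)
  then have "bounded_linear (\<lambda>w :: complex^'a. \<chi> i. s i *\<^sub>R (w $ i))"
    by (simp add: linear_conv_bounded_linear)
  then show ?thesis
    unfolding sform_def by (rule bounded_bilinear.comp[OF bounded_bilinear_inner bounded_linear_ident])
qed

text \<open>As M is a complex matrix, the image of the conjugate of v is not the conjugate of M v.
  But the two images are p + i q and p - i q, with p and q coming from the real and the imaginary
  part of v, and the parallelogram law holds in every coordinate.\<close>

lemma sform_parallelogram:
  fixes M :: "complex^'n^'n" and v :: "complex^'n"
  defines "p \<equiv> M *v cvec (\<chi> i. Re (v $ i))" and "q \<equiv> M *v cvec (\<chi> i. Im (v $ i))"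
  shows "sform s (M *v v) (M *v v) + sform s (M *v (\<chi> i. cnj (v $ i))) (M *v (\<chi> i. cnj (v $ i))) =
    2 * sform s p p + 2 * sform s q q"
proof -
  have "v = cvec (\<chi> i. Re (v $ i)) + \<i> *s cvec (\<chi> i. Im (v $ i))"
    by (simp add: vec_eq_iff cvec_def complex_eq_iff)
  then have 1: "M *v v = p + \<i> *s q"
    unfolding p_def q_def by (metis vec.add vec.scale)
  have "(\<chi> i. cnj (v $ i)) = cvec (\<chi> i. Re (v $ i)) - \<i> *s cvec (\<chi> i. Im (v $ i))"
    by (simp add: vec_eq_iff cvec_def complex_eq_iff)
  then have 2: "M *v (\<chi> i. cnj (v $ i)) = p - \<i> *s q"
    unfolding p_def q_def by (simp add: vec.diff vec.scale)
  have par: "(cmod (a + \<i> * b))\<^sup>2 + (cmod (a - \<i> * b))\<^sup>2 = 2 * (cmod a)\<^sup>2 + 2 * (cmod b)\<^sup>2" for a b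
    unfolding cmod_power2 by (simp add: power2_eq_square algebra_simps)
  have "s i * (cmod (a + \<i> * b))\<^sup>2 + s i * (cmod (a - \<i> * b))\<^sup>2 =
      2 * (s i * (cmod a)\<^sup>2) + 2 * (s i * (cmod b)\<^sup>2)" for a b i
    using arg_cong[OF par[of a b], of "(*) (s i)"] by (simp add: distrib_left mult.left_commute)
  then show ?thesis
    unfolding 1 2 by (simp add: sform_same sum.distrib[symmetric] sum_distrib_left)
qed

text \<open>On an eigenvector, coordinate i of the error is \<mu> - l i times z i, hence at least 2
  * \<epsilon> * |z i| where the sign is negative. As the whole error is at most \<epsilon> * |z|,
  the negative coordinates carry at most a quarter of |z|^2, and the form is at least |z|^2 /
  2.\<close>

lemma sform_eigenvector_pos:
  fixes M :: "complex^'n^'n"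
  assumes v: "A *v v = \<mu> *s v" "M *v v \<noteq> 0"
    and M: "norm (M *v (A *v v) - (\<chi> i. l i * (M *v v) $ i)) \<le> \<epsilon> * norm (M *v v)"
    and s: "\<And>i. \<bar>s i\<bar> = 1" "\<And>i. s i = -1 \<Longrightarrow> cmod (\<mu> - l i) \<ge> g" and g: "2 * \<epsilon> \<le> g" "\<epsilon> > 0"
  shows "sform s (M *v v) (M *v v) > 0"
proof -
  define z where "z = M *v v"
  define E where "E = M *v (A *v v) - (\<chi> i. l i * z $ i)"
  have "g > 0"
    using g by simp
  have E: "E $ i = (\<mu> - l i) * z $ i" for i
    by (simp add: v vec.scale algebra_simps z_def E_def)
  have "(2 * \<epsilon>)\<^sup>2 * ((norm z)\<^sup>2 - sform s z z) = (\<Sum>i\<in>UNIV. (2 * \<epsilon>)\<^sup>2 * ((1 - s i) * (cmod (z $ i))\<^sup>2))"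
    unfolding norm_power2_vec sform_same
    by (simp add: sum_subtractf sum_distrib_left algebra_simps)
  also have "\<dots> \<le> (\<Sum>i\<in>UNIV. 2 * (cmod (E $ i))\<^sup>2)"
  proof (rule sum_mono)
    fix i
    consider "s i = 1" | "s i = -1"
      using s(1)[of i] by linarith
    then show "(2 * \<epsilon>)\<^sup>2 * ((1 - s i) * (cmod (z $ i))\<^sup>2) \<le> 2 * (cmod (E $ i))\<^sup>2"
    proof cases
      case 2
      then have "2 * \<epsilon> \<le> cmod (\<mu> - l i)"
        using s(2) g by force
      then have "(2 * \<epsilon>)\<^sup>2 \<le> (cmod (\<mu> - l i))\<^sup>2"
        using g by (intro power_mono) auto
      from mult_right_mono[OF this, of "(cmod (z $ i))\<^sup>2"] show ?thesis
        by (simp add: E 2 norm_mult power_mult_distrib mult_ac)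
    qed simp
  qed
  also have "\<dots> = 2 * (norm E)\<^sup>2"
    by (simp add: norm_power2_vec[of E] sum_distrib_left)
  also have "\<dots> \<le> 2 * (\<epsilon> * norm z)\<^sup>2"
    using M g by (intro mult_left_mono power_mono) (auto simp: z_def E_def)
  finally have "\<epsilon>\<^sup>2 * (4 * ((norm z)\<^sup>2 - sform s z z)) \<le> \<epsilon>\<^sup>2 * (2 * (norm z)\<^sup>2)"
    by (simp add: power_mult_distrib algebra_simps)
  then have "(norm z)\<^sup>2 \<le> 2 * sform s z z"
    using g by simp
  moreover have "(norm z)\<^sup>2 > 0"
    using v by (simp add: z_def)
  ultimately show ?thesis
    unfolding z_def[symmetric] by (smt (verit))
qed

text \<open>A is real, so the conjugate of an eigenvector for \<mu> is one for the conjugate of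
  \<mu>. The form is positive at both, and by the parallelogram identity at the real or at the
  imaginary part.\<close>

lemma ex_sform_pos:
  fixes M :: "complex^'n^'n" and A :: "real^'n^'n"
  defines "A' \<equiv> map_matrix complex_of_real A"
  assumes \<mu>: "\<mu> \<in> complex_spectrum A" and inj: "\<And>v. M *v v = 0 \<Longrightarrow> v = 0"
    and M: "\<And>v. norm (M *v (A' *v v) - (\<chi> i. l i * (M *v v) $ i)) \<le> \<epsilon> * norm (M *v v)"
    and s: "\<And>i. \<bar>s i\<bar> = 1"
      "\<And>i. s i = -1 \<Longrightarrow> cmod (\<mu> - l i) \<ge> g \<and> cmod (cnj \<mu> - l i) \<ge> g"
    and g: "2 * \<epsilon> \<le> g" "\<epsilon> > 0"
  shows "\<exists>x. sform s (M *v cvec x) (M *v cvec x) > 0"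
proof -
  obtain v where v: "v \<noteq> 0" "A' *v v = \<mu> *s v"
    using \<mu> by (auto simp: complex_spectrum_def A'_def)
  define v' where "v' = (\<chi> i. cnj (v $ i))"
  have "A' *v v' = (\<chi> i. cnj ((A' *v v) $ i))"
    by (simp add: A'_def v'_def matrix_vector_mult_def map_matrix_def vec_eq_iff)
  then have v': "A' *v v' = cnj \<mu> *s v'"
    by (simp add: v) (simp add: v'_def vec_eq_iff)
  have "v' \<noteq> 0"
    using v(1) by (simp add: v'_def vec_eq_iff)
  have "sform s (M *v v) (M *v v) > 0"
    using v inj s g by (intro sform_eigenvector_pos[OF v(2) _ M]) auto
  moreover have "sform s (M *v v') (M *v v') > 0"
    using \<open>v' \<noteq> 0\<close> inj s g by (intro sform_eigenvector_pos[OF v' _ M]) auto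
  ultimately show ?thesis
    using sform_parallelogram[of s M v] unfolding v'_def by (smt (verit))
qed

section \<open>Linearization at an equilibrium\<close>

lemma linear_chart: "linear (\<lambda>x. M *v cvec x)" for M :: "complex^'n^'n"
  by (rule linearI) (simp_all add: cvec_add cvec_scaleR matrix_vector_mult_scaleR_complex vec.add)

text \<open>The last clause concerns the unstable cone: as \<open>\<Phi>\<close> is only defined on real vectors, an
  eigenvector of \<open>\<mu>\<close> cannot be used directly, but if both \<open>\<mu>\<close> and its conjugate are far from the
  \<open>l i\<close> with negative sign then the form is positive at the real or at the imaginary part of it.\<close>

definition near_diagonal_chart ::
    "(real^'n \<Rightarrow> real^'n) \<Rightarrow> real^'n \<Rightarrow> ('n \<Rightarrow> complex) \<Rightarrow> real \<Rightarrow> (real^'n \<Rightarrow> complex^'n) \<Rightarrow> real \<Rightarrow> bool" where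
  "near_diagonal_chart f ys l \<epsilon> \<Phi> d \<longleftrightarrow> linear \<Phi> \<and> inj \<Phi> \<and> d > 0 \<and>
     (\<forall>y. dist y ys < d \<longrightarrow>
        norm (\<Phi> (f y) - (\<chi> i. l i * \<Phi> (y - ys) $ i)) \<le> \<epsilon> * norm (\<Phi> (y - ys))) \<and>
     (\<forall>s \<mu> g. \<mu> \<in> complex_spectrum (jacobian f (at ys)) \<and> 2 * \<epsilon> \<le> g \<and>
        (\<forall>i. \<bar>s i\<bar> = 1 \<and> (s i = -1 \<longrightarrow> cmod (\<mu> - l i) \<ge> g \<and> cmod (cnj \<mu> - l i) \<ge> g)) \<longrightarrow>
        (\<exists>x. sform s (\<Phi> x) (\<Phi> x) > 0))"

text \<open>Half of \<epsilon> is spent on the off-diagonal entries, half on the remainder of the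
  derivative. M comes before d: the constants \<kappa> and K comparing the norm in the chart with
  the original one decide how small the remainder has to be.\<close>

lemma local_normal_form:
  fixes f :: "real^'n \<Rightarrow> real^'n"
  assumes diff: "f differentiable (at ys)" and eq: "f ys = 0"
  shows "\<exists>l. range l = complex_spectrum (jacobian f (at ys)) \<and>
    (\<forall>\<epsilon>>0. \<exists>\<Phi> d. near_diagonal_chart f ys l \<epsilon> \<Phi> d)"
proof -
  define J where "J = jacobian f (at ys)"
  obtain l where l: "range l = complex_spectrum J" and
    ex: "\<And>\<epsilon>. \<epsilon> > 0 \<Longrightarrow> \<exists>M :: complex^'n^'n. (\<forall>v. M *v v = 0 \<longrightarrow> v = 0) \<and>
       (\<forall>v. norm (M *v (map_matrix complex_of_real J *v v) - (\<chi> i. l i * (M *v v) $ i)) \<le> \<epsilon> * norm (M *v v))"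
    by (rule almost_diagonalization[of "map_matrix complex_of_real J"]) (auto simp: complex_spectrum_eq)
  have der: "(f has_derivative (\<lambda>h. J *v h)) (at ys)"
    using diff by (simp add: J_def jacobian_works)
  have "\<exists>\<Phi> d. near_diagonal_chart f ys l \<epsilon> \<Phi> d" if "\<epsilon> > 0" for \<epsilon>
  proof -
    obtain M :: "complex^'n^'n" where M: "\<And>v. M *v v = 0 \<Longrightarrow> v = 0"
       "\<And>v. norm (M *v (map_matrix complex_of_real J *v v) - (\<chi> i. l i * (M *v v) $ i)) \<le> \<epsilon> / 2 * norm (M *v v)"
      using ex[of "\<epsilon> / 2"] \<open>\<epsilon> > 0\<close> by auto
    define \<Phi> where "\<Phi> x = M *v cvec x" for x
    have lin: "linear \<Phi>"
      unfolding \<Phi>_def by (rule linear_chart)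
    have inj: "inj \<Phi>"
      unfolding linear_injective_0[OF lin] by (auto simp: \<Phi>_def dest!: M(1))
    obtain \<kappa> where \<kappa>: "\<kappa> > 0" "\<And>x. \<kappa> * norm x \<le> norm (\<Phi> x)"
      using linear_inj_bounded_below_pos[OF lin inj] by blast
    obtain K where K: "K > 0" "\<And>x. norm (\<Phi> x) \<le> K * norm x"
      using linear_bounded_pos[OF lin] by blast
    have "\<epsilon> * \<kappa> / (2 * K) > 0"
      using \<open>\<epsilon> > 0\<close> \<kappa> K by simp
    then obtain d where d: "d > 0"
      "\<And>y. norm (y - ys) < d \<Longrightarrow> norm (f y - f ys - J *v (y - ys)) \<le> \<epsilon> * \<kappa> / (2 * K) * norm (y - ys)"
      using der unfolding has_derivative_at_alt by meson
    have "norm (\<Phi> (f y) - (\<chi> i. l i * \<Phi> (y - ys) $ i)) \<le> \<epsilon> * norm (\<Phi> (y - ys))" if "dist y ys < d" for y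
    proof -
      define h where "h = y - ys"
      have "\<Phi> (f y) - (\<chi> i. l i * \<Phi> h $ i) = \<Phi> (f y - J *v h) + (\<Phi> (J *v h) - (\<chi> i. l i * \<Phi> h $ i))"
        by (simp add: linear_diff[OF lin])
      then have "norm (\<Phi> (f y) - (\<chi> i. l i * \<Phi> h $ i)) \<le>
          norm (\<Phi> (f y - J *v h)) + norm (\<Phi> (J *v h) - (\<chi> i. l i * \<Phi> h $ i))"
        using norm_triangle_ineq by metis
      moreover have "norm (\<Phi> (f y - J *v h)) \<le> \<epsilon> / 2 * norm (\<Phi> h)"
      proof -
        have "norm (\<Phi> (f y - J *v h)) \<le> K * (\<epsilon> * \<kappa> / (2 * K) * norm h)"
          using K d(2)[of y] that by (intro order.trans[OF K(2)] mult_left_mono) (auto simp: eq h_def dist_norm)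
        also have "\<dots> = \<epsilon> / 2 * (\<kappa> * norm h)"
          using K by simp
        also have "\<dots> \<le> \<epsilon> / 2 * norm (\<Phi> h)"
          using \<kappa>(2) \<open>\<epsilon> > 0\<close> by (intro mult_left_mono) auto
        finally show ?thesis .
      qed
      moreover have "norm (\<Phi> (J *v h) - (\<chi> i. l i * \<Phi> h $ i)) \<le> \<epsilon> / 2 * norm (\<Phi> h)"
        using M(2)[of "cvec h"] by (simp add: \<Phi>_def map_matrix_mult_cvec)
      ultimately show ?thesis
        by (simp add: h_def)
    qed
    moreover have "\<exists>x. sform s (\<Phi> x) (\<Phi> x) > 0"
      if "\<mu> \<in> complex_spectrum J" "2 * \<epsilon> \<le> g"
         "\<forall>i. \<bar>s i\<bar> = 1 \<and> (s i = -1 \<longrightarrow> cmod (\<mu> - l i) \<ge> g \<and> cmod (cnj \<mu> - l i) \<ge> g)" for s \<mu> g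
      unfolding \<Phi>_def by (rule ex_sform_pos[OF that(1) M, where g = g]) (use that \<open>\<epsilon> > 0\<close> in auto)
    ultimately show ?thesis
      using lin inj d(1) unfolding near_diagonal_chart_def J_def[symmetric] by blast
  qed
  with l show ?thesis
    unfolding J_def by blast
qed

lemma ex_small_scaleR:
  fixes x :: "'a::real_normed_vector"
  assumes "d > 0"
  shows "\<exists>c>0. norm (c *\<^sub>R x) < d"
proof (intro exI[of _ "d / (norm x + 1)"] conjI)
  have "d * norm x < d * (norm x + 1)"
    using assms by simp
  then show "norm ((d / (norm x + 1)) *\<^sub>R x) < d"
    using assms by (simp add: pos_divide_less_eq add_nonneg_pos)
qed (use assms in \<open>simp add: add_nonneg_pos\<close>)

section \<open>Monotonicity of the form along the flow\<close>

lemma sform_diagonal: "sform s z (\<chi> i. l i * z $ i) = (\<Sum>i\<in>UNIV. s i * Re (l i) * (cmod (z $ i))\<^sup>2)"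
proof -
  have "w \<bullet> (a * w) = Re a * (cmod w)\<^sup>2" for a w
    unfolding cmod_power2 by (simp add: inner_complex_def power2_eq_square algebra_simps)
  then show ?thesis
    by (simp add: sform_altdef mult.assoc)
qed

text \<open>The derivative of V is twice the form of z and \<Phi> (f y). Its diagonal part is at
  least \<epsilon> * |z|^2, and the error is at most that by Cauchy-Schwarz. Closeness is asked only
  inside the interval, because the lemma is applied up to a first exit time, where it may
  fail.\<close>

lemma sform_mono_along_solution:
  fixes f :: "real^'n \<Rightarrow> real^'n"
  assumes lin: "linear \<Phi>" and sol: "ode_solution_on f I y" and I: "{a..b} \<subseteq> I" and "a \<le> b"
    and near: "\<And>t. a < t \<Longrightarrow> t < b \<Longrightarrow> dist (y t) ys < d"
    and s: "\<And>i. \<bar>s i\<bar> = 1" "\<And>i. s i * Re (l i) \<ge> \<epsilon>"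
    and est: "\<And>y. dist y ys < d \<Longrightarrow>
      norm (\<Phi> (f y) - (\<chi> i. l i * \<Phi> (y - ys) $ i)) \<le> \<epsilon> * norm (\<Phi> (y - ys))"
  shows "sform s (\<Phi> (y a - ys)) (\<Phi> (y a - ys)) \<le> sform s (\<Phi> (y b - ys)) (\<Phi> (y b - ys))"
proof (cases "a = b")
  case False
  then have "a < b"
    using \<open>a \<le> b\<close> by simp
  define z where "z t = \<Phi> (y t - ys)" for t
  define V where "V t = sform s (z t) (z t)" for t
  have dz: "(z has_vector_derivative \<Phi> (f (y t))) (at t within {a..b})" if "t \<in> {a..b}" for t
  proof -
    have "(y has_vector_derivative f (y t)) (at t within {a..b})"
      using sol I that unfolding ode_solution_on_def by (meson has_vector_derivative_within_subset subset_iff)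
    then have "((\<lambda>t. y t - ys) has_vector_derivative f (y t)) (at t within {a..b})"
      by (auto intro!: derivative_eq_intros)
    then show ?thesis
      unfolding z_def by (rule bounded_linear.has_vector_derivative[OF linear_conv_bounded_linear[THEN iffD1, OF lin]])
  qed
  have dV: "(V has_vector_derivative 2 * sform s (z t) (\<Phi> (f (y t)))) (at t within {a..b})" if "t \<in> {a..b}" for t
    unfolding V_def
    using bounded_bilinear.has_vector_derivative[OF bounded_bilinear_sform dz[OF that] dz[OF that], of s]
    by (simp add: sform_commute)
  have "continuous_on {a..b} V"
    using dV has_vector_derivative_continuous continuous_on_eq_continuous_within by blast
  moreover have "(V has_derivative (\<lambda>h. h * (2 * sform s (z t) (\<Phi> (f (y t)))))) (at t)" if "a < t" "t < b" for t
    using dV[of t] that at_within_Icc_at[of a t b] by (simp add: has_vector_derivative_def)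
  ultimately obtain t where t: "a < t" "t < b" "V b - V a = (b - a) * (2 * sform s (z t) (\<Phi> (f (y t))))"
    using mvt[OF \<open>a < b\<close>, of V "\<lambda>t h. h * (2 * sform s (z t) (\<Phi> (f (y t))))"] by blast
  define D where "D = (\<chi> i. l i * z t $ i)"
  have "\<bar>sform s (z t) (\<Phi> (f (y t)) - D)\<bar> \<le> norm (z t) * norm (\<Phi> (f (y t)) - D)"
    by (rule abs_sform_le) (rule s)
  also have "\<dots> \<le> norm (z t) * (\<epsilon> * norm (z t))"
    using est[OF near[OF t(1,2)]] by (intro mult_left_mono) (auto simp: D_def z_def)
  finally have "\<bar>sform s (z t) (\<Phi> (f (y t)) - D)\<bar> \<le> \<epsilon> * (norm (z t))\<^sup>2"
    by (simp add: power2_eq_square algebra_simps)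
  moreover have "sform s (z t) D \<ge> \<epsilon> * (norm (z t))\<^sup>2"
    unfolding D_def sform_diagonal norm_power2_vec sum_distrib_left
    by (intro sum_mono mult_right_mono s) auto
  moreover have "sform s (z t) (\<Phi> (f (y t))) = sform s (z t) (\<Phi> (f (y t)) - D) + sform s (z t) D"
    by (simp add: sform_add_right[symmetric])
  ultimately have "sform s (z t) (\<Phi> (f (y t))) \<ge> 0"
    by linarith
  then have "V b - V a \<ge> 0"
    using t \<open>a < b\<close> by simp
  then show ?thesis
    by (simp add: V_def z_def)
qed simp

section \<open>Linearized stability of the differential equation\<close>

text \<open>With all signs -1 the form is minus the squared chart norm, which therefore cannot
  increase while the solution stays within d. By the comparison with \<kappa> and K, a start below
  \<kappa> * \<rho> / K has too small a chart norm to reach distance \<rho>.\<close>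

lemma ode_stable_if_spectrum_negative:
  fixes f :: "real^'n \<Rightarrow> real^'n"
  assumes diff: "f differentiable (at ys)" and eq: "f ys = 0"
    and neg: "\<And>\<mu>. \<mu> \<in> complex_spectrum (jacobian f (at ys)) \<Longrightarrow> Re \<mu> < 0"
  shows "ode_stable f ys"
proof -
  obtain l :: "'n \<Rightarrow> complex" where l: "range l = complex_spectrum (jacobian f (at ys))" and
    ex: "\<And>\<epsilon>. \<epsilon> > 0 \<Longrightarrow> \<exists>\<Phi> d. near_diagonal_chart f ys l \<epsilon> \<Phi> d"
    using local_normal_form[OF diff eq] by blast
  define \<epsilon> where "\<epsilon> = Min (range (\<lambda>i. - Re (l i)))"
  have "\<epsilon> > 0"
    using neg l by (auto simp: \<epsilon>_def)
  have \<epsilon>: "\<epsilon> \<le> - Re (l i)" for i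
    by (simp add: \<epsilon>_def)
  obtain \<Phi> d where lin: "linear \<Phi>" and inj: "inj \<Phi>" and "d > 0" and
    est: "\<And>y. dist y ys < d \<Longrightarrow>
          norm (\<Phi> (f y) - (\<chi> i. l i * \<Phi> (y - ys) $ i)) \<le> \<epsilon> * norm (\<Phi> (y - ys))"
    using ex[OF \<open>\<epsilon> > 0\<close>] unfolding near_diagonal_chart_def by blast
  obtain \<kappa> where \<kappa>: "\<kappa> > 0" "\<And>x. \<kappa> * norm x \<le> norm (\<Phi> x)"
    using linear_inj_bounded_below_pos[OF lin inj] by blast
  obtain K where K: "K > 0" "\<And>x. norm (\<Phi> x) \<le> K * norm x"
    using linear_bounded_pos[OF lin] by blast
  show ?thesis
    unfolding ode_stable_def
  proof (intro allI impI)
    fix e :: real assume "e > 0"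
    define \<rho> where "\<rho> = min e d"
    have "\<rho> > 0"
      using \<open>e > 0\<close> \<open>d > 0\<close> by (simp add: \<rho>_def)
    have "dist (y t) ys < \<rho>"
      if sol: "ode_solution_on f {0..<T} y" and start: "dist (y 0) ys < \<kappa> * \<rho> / K" and t: "t \<in> {0..<T}" for T y t
    proof (rule ccontr)
      assume far: "\<not> dist (y t) ys < \<rho>"
      \<comment> \<open>S is compact, so its minimum r is the first exit time; before r the distance
        is below \<rho> \<le> d.\<close>
      define S where "S = {x \<in> {0..t}. dist (y x) ys \<ge> \<rho>}"
      have "continuous_on {0..<T} y"
        using sol has_vector_derivative_continuous continuous_on_eq_continuous_within
        unfolding ode_solution_on_def by blast
      then have "continuous_on {0..t} (\<lambda>x. dist (y x) ys)"
        using t by (intro continuous_on_dist continuous_on_const) (auto elim: continuous_on_subset)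
      then have "closed S"
        unfolding S_def using continuous_on_closed_Collect_le[of "{0..t}" "\<lambda>_. \<rho>" "\<lambda>x. dist (y x) ys"]
        by (auto intro: continuous_on_const)
      moreover have "S \<subseteq> {0..t}" "t \<in> S"
        using t far by (auto simp: S_def)
      ultimately have "compact S" "S \<noteq> {}"
        using bounded_subset[OF bounded_closed_interval] by (auto simp: compact_eq_bounded_closed)
      then obtain r where r: "r \<in> S" "\<And>x. x \<in> S \<Longrightarrow> r \<le> x"
        using compact_attains_inf[of S] by auto
      have "dist (y x) ys < d" if "0 < x" "x < r" for x
      proof -
        have "x \<notin> S"
          using r(2)[of x] that by auto
        then show ?thesis
          using that r(1) by (auto simp: S_def \<rho>_def)
      qed
      then have "sform (\<lambda>_. -1) (\<Phi> (y 0 - ys)) (\<Phi> (y 0 - ys)) \<le> sform (\<lambda>_. -1) (\<Phi> (y r - ys)) (\<Phi> (y r - ys))"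
        using r(1) t \<epsilon> est
        by (intro sform_mono_along_solution[OF lin sol, where d = d and l = l and \<epsilon> = \<epsilon>]) (auto simp: S_def)
      then have "(norm (\<Phi> (y r - ys)))\<^sup>2 \<le> (norm (\<Phi> (y 0 - ys)))\<^sup>2"
        by (simp add: sform_same sum_negf norm_power2_vec)
      then have "norm (\<Phi> (y r - ys)) \<le> norm (\<Phi> (y 0 - ys))"
        by (rule power2_le_imp_le) simp
      moreover have "\<kappa> * \<rho> \<le> \<kappa> * norm (y r - ys)"
        using r(1) \<kappa>(1) by (intro mult_left_mono) (auto simp: S_def dist_norm)
      moreover have "K * norm (y 0 - ys) < \<kappa> * \<rho>"
        using start K(1) by (simp add: dist_norm pos_less_divide_eq mult.commute)
      ultimately show False
        using \<kappa>(2)[of "y r - ys"] K(2)[of "y 0 - ys"] by linarith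
    qed
    moreover have "\<kappa> * \<rho> / K > 0"
      using \<kappa>(1) K(1) \<open>\<rho> > 0\<close> by simp
    ultimately show "\<exists>\<delta>>0. \<forall>T>0. \<forall>y. ode_solution_on f {0..<T} y \<and> dist (y 0) ys < \<delta> \<longrightarrow>
        (\<forall>t\<in>{0..<T}. dist (y t) ys < e)"
      by (intro exI[of _ "\<kappa> * \<rho> / K"]) (auto simp: \<rho>_def)
  qed
qed

text \<open>If Re \<mu> > 0, a solution starts arbitrarily close to the equilibrium with V > 0.
  Stability keeps it in the chart, so V cannot decrease; attractivity forces V to tend to 0. This
  contradiction uses monotonicity of V only, not a growth rate.\<close>

lemma asymptotically_stable_hyperbolic_imp_spectrum_negative:
  fixes f :: "real^'n \<Rightarrow> real^'n"
  assumes diff: "f differentiable (at ys)" and stable: "ode_asymptotically_stable_equilibrium f ys"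
    and hyp: "hyperbolic f ys" and \<mu>: "\<mu> \<in> complex_spectrum (jacobian f (at ys))"
  shows "Re \<mu> < 0"
proof (rule ccontr)
  assume "\<not> Re \<mu> < 0"
  then have "Re \<mu> > 0"
    using hyp \<mu> unfolding hyperbolic_def by force
  have eq: "f ys = 0"
    using stable by (simp add: ode_asymptotically_stable_equilibrium_def ode_equilibrium_def)
  obtain l :: "'n \<Rightarrow> complex" where l: "range l = complex_spectrum (jacobian f (at ys))" and
    ex: "\<And>\<epsilon>. \<epsilon> > 0 \<Longrightarrow> \<exists>\<Phi> d. near_diagonal_chart f ys l \<epsilon> \<Phi> d"
    using local_normal_form[OF diff eq] by blast
  define m where "m = Min (range (\<lambda>i. \<bar>Re (l i)\<bar>))"
  have "l i \<in> complex_spectrum (jacobian f (at ys))" for i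
    using l by auto
  then have "m > 0"
    using hyp by (auto simp: m_def hyperbolic_def)
  have m: "m \<le> \<bar>Re (l i)\<bar>" for i
    by (simp add: m_def)
  \<comment> \<open>The bound m makes V monotone. The bound Re \<mu> / 2 serves the cone: a negative
    sign means Re (l i) \<le> 0, so \<mu> and its conjugate are at distance at least Re \<mu> from l
    i.\<close>
  define \<epsilon> where "\<epsilon> = min m (Re \<mu> / 2)"
  have "\<epsilon> > 0"
    using \<open>m > 0\<close> \<open>Re \<mu> > 0\<close> by (simp add: \<epsilon>_def)
  have "2 * \<epsilon> \<le> Re \<mu>"
    by (simp add: \<epsilon>_def)
  obtain \<Phi> d where lin: "linear \<Phi>" and inj: "inj \<Phi>" and "d > 0" and
    est: "\<And>y. dist y ys < d \<Longrightarrow>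
          norm (\<Phi> (f y) - (\<chi> i. l i * \<Phi> (y - ys) $ i)) \<le> \<epsilon> * norm (\<Phi> (y - ys))" and
    pos: "\<And>s \<mu> g. \<mu> \<in> complex_spectrum (jacobian f (at ys)) \<and> 2 * \<epsilon> \<le> g \<and>
          (\<forall>i. \<bar>s i\<bar> = 1 \<and> (s i = -1 \<longrightarrow> cmod (\<mu> - l i) \<ge> g \<and> cmod (cnj \<mu> - l i) \<ge> g)) \<Longrightarrow>
          (\<exists>x. sform s (\<Phi> x) (\<Phi> x) > 0)"
    using ex[OF \<open>\<epsilon> > 0\<close>] unfolding near_diagonal_chart_def by blast
  define s :: "'n \<Rightarrow> real" where "s i = (if Re (l i) > 0 then 1 else -1)" for i
  have s1: "\<bar>s i\<bar> = 1" for i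
    by (simp add: s_def)
  have s2: "s i * Re (l i) \<ge> \<epsilon>" for i
    using m[of i] by (auto simp: s_def \<epsilon>_def)
  have "cmod (\<mu> - l i) \<ge> Re \<mu> \<and> cmod (cnj \<mu> - l i) \<ge> Re \<mu>" if "s i = -1" for i
    using that abs_Re_le_cmod[of "\<mu> - l i"] abs_Re_le_cmod[of "cnj \<mu> - l i"] \<open>Re \<mu> > 0\<close>
    by (auto simp: s_def split: if_splits)
  then obtain x where x: "sform s (\<Phi> x) (\<Phi> x) > 0"
    using pos[of \<mu> "Re \<mu>" s] \<mu> s1 \<open>2 * \<epsilon> \<le> Re \<mu>\<close> by blast
  obtain \<delta>1 where \<delta>1: "\<delta>1 > 0" "\<And>T y t. T > 0 \<Longrightarrow> ode_solution_on f {0..<T} y \<Longrightarrow> dist (y 0) ys < \<delta>1 \<Longrightarrow>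
      t \<in> {0..<T} \<Longrightarrow> dist (y t) ys < d"
    using stable \<open>d > 0\<close> unfolding ode_asymptotically_stable_equilibrium_def ode_stable_def by meson
  obtain \<delta>2 where \<delta>2: "\<delta>2 > 0" "\<And>y0. dist y0 ys < \<delta>2 \<Longrightarrow> \<exists>y. ode_solution_on f {0..} y \<and> y 0 = y0"
      "\<And>y0 y. dist y0 ys < \<delta>2 \<Longrightarrow> ode_solution_on f {0..} y \<Longrightarrow> y 0 = y0 \<Longrightarrow> (y \<longlongrightarrow> ys) at_top"
    using stable unfolding ode_asymptotically_stable_equilibrium_def ode_attractive_def by meson
  obtain c where c: "c > 0" "norm (c *\<^sub>R x) < min \<delta>1 \<delta>2"
    using ex_small_scaleR[of "min \<delta>1 \<delta>2" x] \<open>\<delta>1 > 0\<close> \<open>\<delta>2 > 0\<close> by auto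
  have near0: "dist (ys + c *\<^sub>R x) ys < \<delta>1" "dist (ys + c *\<^sub>R x) ys < \<delta>2"
    using c by (auto simp: dist_norm)
  obtain y where sol: "ode_solution_on f {0..} y" and y0: "y 0 = ys + c *\<^sub>R x"
    using \<delta>2(2)[OF near0(2)] by blast
  have lim: "(y \<longlongrightarrow> ys) at_top"
    by (rule \<delta>2(3)[OF near0(2) sol y0])
  have near: "dist (y t) ys < d" if "t \<ge> 0" for t
  proof (rule \<delta>1(2))
    show "ode_solution_on f {0..<t + 1} y"
      using sol unfolding ode_solution_on_def
      by (auto elim!: ballE intro: has_vector_derivative_within_subset[where S = "{0..}"])
  qed (use that near0 y0 in auto)
  have "sform s (\<Phi> (y 0 - ys)) (\<Phi> (y 0 - ys)) \<le> sform s (\<Phi> (y t - ys)) (\<Phi> (y t - ys))" if "t \<ge> 0" for t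
    using that near s1 s2 est
    by (intro sform_mono_along_solution[OF lin sol, where d = d and l = l and \<epsilon> = \<epsilon>]) auto
  then have "eventually (\<lambda>t. sform s (\<Phi> (y 0 - ys)) (\<Phi> (y 0 - ys)) \<le> sform s (\<Phi> (y t - ys)) (\<Phi> (y t - ys))) at_top"
    using eventually_ge_at_top[of 0] by (rule eventually_mono[rotated])
  moreover have "((\<lambda>t. sform s (\<Phi> (y t - ys)) (\<Phi> (y t - ys))) \<longlongrightarrow> 0) at_top"
  proof -
    have "bounded_linear \<Phi>"
      using lin by (simp add: linear_conv_bounded_linear)
    moreover have "((\<lambda>t. y t - ys) \<longlongrightarrow> 0) at_top"
      using tendsto_diff[OF lim tendsto_const[of ys]] by simp
    ultimately have "((\<lambda>t. \<Phi> (y t - ys)) \<longlongrightarrow> 0) at_top"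
      using bounded_linear.tendsto_zero by blast
    then show ?thesis
      using bounded_bilinear.tendsto_zero[OF bounded_bilinear_sform] by blast
  qed
  ultimately have "sform s (\<Phi> (y 0 - ys)) (\<Phi> (y 0 - ys)) \<le> 0"
    by (intro tendsto_lowerbound) auto
  moreover have "sform s (\<Phi> (y 0 - ys)) (\<Phi> (y 0 - ys)) = c\<^sup>2 * sform s (\<Phi> x) (\<Phi> x)"
    by (simp add: y0 linear_scale[OF lin] sform_scaleR)
  ultimately show False
    using x c(1) by (simp add: mult_le_0_iff)
qed

section \<open>Linearized stability of the Euler map\<close>

lemma norm_scaled_le:
  fixes z :: "complex^'n"
  assumes "\<And>i. cmod (p i) \<le> B" "B \<ge> 0"
  shows "norm (\<chi> i. p i * z $ i) \<le> B * norm z"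
proof -
  have "norm (\<chi> i. p i * z $ i) \<le> norm (B *\<^sub>R z)"
    using assms by (intro norm_le_componentwise_cart) (simp add: norm_mult mult_right_mono)
  then show ?thesis
    using \<open>B \<ge> 0\<close> by simp
qed

text \<open>The diagonal step gains 2 * c * |z|^2 over \<gamma> times the old form. One half of this
  pays for the cross term and the square of the error, the other half is kept. Stability takes
  \<gamma> = 1, instability \<gamma> > 1.\<close>

lemma sform_diagonal_step_lower_bound:
  fixes z :: "complex^'n"
  assumes s: "\<And>i. \<bar>s i\<bar> = 1" and B: "\<And>i. cmod (p i) \<le> B" "B \<ge> 0"
    and gap: "\<And>i. 2 * c \<le> s i * ((cmod (p i))\<^sup>2 - \<gamma>)"
    and e: "norm (w - (\<chi> i. p i * z $ i)) \<le> \<eta> * norm z" and \<eta>: "\<eta> \<ge> 0" "2 * B * \<eta> + \<eta>\<^sup>2 \<le> c"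
  shows "\<gamma> * sform s z z + c * (norm z)\<^sup>2 \<le> sform s w w"
proof -
  define D where "D = (\<chi> i. p i * z $ i)"
  define E where "E = w - D"
  have nD: "norm D \<le> B * norm z" and nE: "norm E \<le> \<eta> * norm z"
    using norm_scaled_le[OF B] e by (auto simp: D_def E_def)
  have "\<gamma> * sform s z z + 2 * c * (norm z)\<^sup>2 =
      (\<Sum>i\<in>UNIV. \<gamma> * s i * (cmod (z $ i))\<^sup>2 + 2 * c * (cmod (z $ i))\<^sup>2)"
    by (simp add: sform_same norm_power2_vec sum.distrib sum_distrib_left mult.assoc)
  also have "\<dots> \<le> (\<Sum>i\<in>UNIV. s i * (cmod (D $ i))\<^sup>2)"
  proof (rule sum_mono)
    fix i
    have "2 * c * (cmod (z $ i))\<^sup>2 \<le> s i * ((cmod (p i))\<^sup>2 - \<gamma>) * (cmod (z $ i))\<^sup>2"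
      using gap by (intro mult_right_mono) auto
    then show "\<gamma> * s i * (cmod (z $ i))\<^sup>2 + 2 * c * (cmod (z $ i))\<^sup>2 \<le> s i * (cmod (D $ i))\<^sup>2"
      by (simp add: D_def norm_mult power_mult_distrib algebra_simps)
  qed
  also have "\<dots> = sform s D D"
    by (simp add: sform_same)
  finally have "\<gamma> * sform s z z + 2 * c * (norm z)\<^sup>2 \<le> sform s D D" .
  moreover have "sform s w w = sform s D D + 2 * sform s D E + sform s E E"
  proof -
    have "w = D + E"
      by (simp add: E_def)
    then show ?thesis
      by (simp add: sform_add_left sform_add_right sform_commute[of s E D])
  qed
  moreover have "2 * \<bar>sform s D E\<bar> + \<bar>sform s E E\<bar> \<le> c * (norm z)\<^sup>2"
  proof -
    have "2 * \<bar>sform s D E\<bar> + \<bar>sform s E E\<bar> \<le> 2 * (norm D * norm E) + norm E * norm E"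
      by (intro add_mono mult_left_mono abs_sform_le s) auto
    also have "\<dots> \<le> 2 * ((B * norm z) * (\<eta> * norm z)) + (\<eta> * norm z) * (\<eta> * norm z)"
      using nD nE B \<eta> by (intro add_mono mult_mono mult_left_mono) auto
    also have "\<dots> = (2 * B * \<eta> + \<eta>\<^sup>2) * (norm z)\<^sup>2"
      by (simp add: power2_eq_square algebra_simps)
    also have "\<dots> \<le> c * (norm z)\<^sup>2"
      using \<eta> by (intro mult_right_mono) auto
    finally show ?thesis .
  qed
  moreover have "2 * c * (norm z)\<^sup>2 = c * (norm z)\<^sup>2 + c * (norm z)\<^sup>2"
    by simp
  ultimately show ?thesis
    by linarith
qed

text \<open>The chart error of f enters the step multiplied by \<sigma>, hence the bound \<eta> /
  \<sigma>. It is uniform over all charts, so that \<epsilon> can be lowered further for the cone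
  condition before a chart is chosen.\<close>

lemma sform_growth_along_euler_step:
  fixes f :: "real^'n \<Rightarrow> real^'n" and l :: "'n \<Rightarrow> complex"
  assumes "\<sigma> > 0" "c > 0" and s: "\<And>i. \<bar>s i\<bar> = 1"
    and gap: "\<And>i. 2 * c \<le> s i * ((cmod (1 + \<sigma> * l i))\<^sup>2 - \<gamma>)"
  shows "\<exists>\<epsilon>0>0. \<forall>\<epsilon> \<Phi> d y. 0 < \<epsilon> \<and> \<epsilon> \<le> \<epsilon>0 \<and> near_diagonal_chart f ys l \<epsilon> \<Phi> d \<and> dist y ys < d \<longrightarrow>
       \<gamma> * sform s (\<Phi> (y - ys)) (\<Phi> (y - ys)) + c * (norm (\<Phi> (y - ys)))\<^sup>2 \<le>
       sform s (\<Phi> (y + \<sigma> *\<^sub>R f y - ys)) (\<Phi> (y + \<sigma> *\<^sub>R f y - ys))"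
proof -
  define B where "B = Max (range (\<lambda>i. cmod (1 + \<sigma> * l i)))"
  have B: "cmod (1 + \<sigma> * l i) \<le> B" for i
    by (simp add: B_def)
  then have "B \<ge> 0"
    using norm_ge_zero order.trans by blast
  \<comment> \<open>With \<eta> \<le> 1 the square of \<eta> is at most \<eta>, so the total error
    is at most \<eta> * (2 * B + 1).\<close>
  define \<eta> where "\<eta> = min 1 (c / (2 * B + 1))"
  have "\<eta> > 0"
    using \<open>c > 0\<close> \<open>B \<ge> 0\<close> by (simp add: \<eta>_def add_nonneg_pos)
  have "\<eta> / \<sigma> > 0"
    using \<open>\<eta> > 0\<close> \<open>\<sigma> > 0\<close> by simp
  moreover have "\<gamma> * sform s (\<Phi> (y - ys)) (\<Phi> (y - ys)) + c * (norm (\<Phi> (y - ys)))\<^sup>2 \<le>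
       sform s (\<Phi> (y + \<sigma> *\<^sub>R f y - ys)) (\<Phi> (y + \<sigma> *\<^sub>R f y - ys))"
    if \<epsilon>: "0 < \<epsilon>" "\<epsilon> \<le> \<eta> / \<sigma>" and chart: "near_diagonal_chart f ys l \<epsilon> \<Phi> d" and y: "dist y ys < d"
    for \<epsilon> \<Phi> d y
  proof -
    have lin: "linear \<Phi>"
      using chart by (simp add: near_diagonal_chart_def)
    define z where "z = \<Phi> (y - ys)"
    define w where "w = \<Phi> (y + \<sigma> *\<^sub>R f y - ys)"
    have "w = z + \<sigma> *\<^sub>R \<Phi> (f y)"
      unfolding w_def z_def
      by (metis add_diff_eq add.commute linear_add[OF lin] linear_scale[OF lin])
    then have "w - (\<chi> i. (1 + \<sigma> * l i) * z $ i) = \<sigma> *\<^sub>R (\<Phi> (f y) - (\<chi> i. l i * z $ i))"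
      by (simp add: vec_eq_iff) (simp add: scaleR_conv_of_real algebra_simps)
    then have "norm (w - (\<chi> i. (1 + \<sigma> * l i) * z $ i)) = \<sigma> * norm (\<Phi> (f y) - (\<chi> i. l i * z $ i))"
      using \<open>\<sigma> > 0\<close> by simp
    also have "\<dots> \<le> \<sigma> * (\<epsilon> * norm z)"
      using chart y \<open>\<sigma> > 0\<close> by (intro mult_left_mono) (auto simp: near_diagonal_chart_def z_def)
    also have "\<dots> \<le> \<sigma> * (\<eta> / \<sigma> * norm z)"
      using \<epsilon> \<open>\<sigma> > 0\<close> by (intro mult_left_mono mult_right_mono) auto
    also have "\<dots> = \<eta> * norm z"
      using \<open>\<sigma> > 0\<close> by simp
    finally have *: "norm (w - (\<chi> i. (1 + \<sigma> * l i) * z $ i)) \<le> \<eta> * norm z" .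
    have "\<eta> * \<eta> \<le> \<eta> * 1"
      using \<open>\<eta> > 0\<close> by (intro mult_left_mono) (auto simp: \<eta>_def)
    then have "2 * B * \<eta> + \<eta>\<^sup>2 \<le> \<eta> * (2 * B + 1)"
      by (simp add: power2_eq_square algebra_simps)
    also have "\<dots> \<le> c"
      using \<open>B \<ge> 0\<close> by (simp add: \<eta>_def pos_le_divide_eq[symmetric] add_nonneg_pos)
    finally have "2 * B * \<eta> + \<eta>\<^sup>2 \<le> c" .
    then show ?thesis
      using sform_diagonal_step_lower_bound[OF s B \<open>B \<ge> 0\<close> gap *] \<open>\<eta> > 0\<close> by (simp add: z_def w_def)
  qed
  ultimately show ?thesis
    by blast
qed

text \<open>With all signs -1 and \<gamma> = 1 the one-step estimate says that the squared chart
  norm shrinks by the factor 1 - c.\<close>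

lemma map_asymptotically_stable_if_contracting:
  fixes f :: "real^'n \<Rightarrow> real^'n"
  assumes diff: "f differentiable (at ys)" and eq: "f ys = 0" and "\<sigma> > 0"
    and contr: "\<And>\<mu>. \<mu> \<in> complex_spectrum (jacobian f (at ys)) \<Longrightarrow> cmod (1 + \<sigma> * \<mu>) < 1"
  shows "map_asymptotically_stable_equilibrium (\<lambda>y. y + \<sigma> *\<^sub>R f y) ys"
proof -
  define G where "G y = y + \<sigma> *\<^sub>R f y" for y
  obtain l :: "'n \<Rightarrow> complex" where l: "range l = complex_spectrum (jacobian f (at ys))" and
    ex: "\<And>\<epsilon>. \<epsilon> > 0 \<Longrightarrow> \<exists>\<Phi> d. near_diagonal_chart f ys l \<epsilon> \<Phi> d"
    using local_normal_form[OF diff eq] by blast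
  define c where "c = Min (range (\<lambda>i. 1 - (cmod (1 + \<sigma> * l i))\<^sup>2)) / 2"
  have "cmod (1 + \<sigma> * l i) < 1" for i
    using contr l by blast
  then have "(cmod (1 + \<sigma> * l i))\<^sup>2 < 1" for i
    by (simp add: power_less_one_iff abs_square_less_1)
  then have "c > 0"
    by (auto simp: c_def)
  have c: "2 * c \<le> 1 - (cmod (1 + \<sigma> * l i))\<^sup>2" for i
    by (simp add: c_def)
  \<comment> \<open>Any index will do; the inequality makes 1 - c nonnegative, so that q is its
    genuine square root.\<close>
  from this[of undefined] have "2 * c \<le> 1"
    using zero_le_power2[of "cmod (1 + \<sigma> * l undefined)"] by linarith
  have "\<exists>\<epsilon>0>0. \<forall>\<epsilon> \<Phi> d y. 0 < \<epsilon> \<and> \<epsilon> \<le> \<epsilon>0 \<and> near_diagonal_chart f ys l \<epsilon> \<Phi> d \<and> dist y ys < d \<longrightarrow>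
       1 * sform (\<lambda>_. -1) (\<Phi> (y - ys)) (\<Phi> (y - ys)) + c * (norm (\<Phi> (y - ys)))\<^sup>2 \<le>
       sform (\<lambda>_. -1) (\<Phi> (y + \<sigma> *\<^sub>R f y - ys)) (\<Phi> (y + \<sigma> *\<^sub>R f y - ys))"
    by (rule sform_growth_along_euler_step[OF \<open>\<sigma> > 0\<close> \<open>c > 0\<close>]) (use c in auto)
  then obtain \<epsilon> where "\<epsilon> > 0" and \<epsilon>: "\<And>\<Phi> d y. near_diagonal_chart f ys l \<epsilon> \<Phi> d \<Longrightarrow> dist y ys < d \<Longrightarrow>
       1 * sform (\<lambda>_. -1) (\<Phi> (y - ys)) (\<Phi> (y - ys)) + c * (norm (\<Phi> (y - ys)))\<^sup>2 \<le>
       sform (\<lambda>_. -1) (\<Phi> (y + \<sigma> *\<^sub>R f y - ys)) (\<Phi> (y + \<sigma> *\<^sub>R f y - ys))"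
    by blast
  obtain \<Phi> d where chart: "near_diagonal_chart f ys l \<epsilon> \<Phi> d"
    using ex[OF \<open>\<epsilon> > 0\<close>] by blast
  then have lin: "linear \<Phi>" and inj: "inj \<Phi>" and "d > 0"
    by (auto simp: near_diagonal_chart_def)
  obtain \<kappa> where \<kappa>: "\<kappa> > 0" "\<And>x. \<kappa> * norm x \<le> norm (\<Phi> x)"
    using linear_inj_bounded_below_pos[OF lin inj] by blast
  obtain K where K: "K > 0" "\<And>x. norm (\<Phi> x) \<le> K * norm x"
    using linear_bounded_pos[OF lin] by blast
  define q where "q = sqrt (1 - c)"
  have q: "0 \<le> q" "q < 1" "q\<^sup>2 = 1 - c"
    using \<open>2 * c \<le> 1\<close> \<open>c > 0\<close> by (auto simp: q_def)
  have step: "norm (\<Phi> (G y - ys)) \<le> q * norm (\<Phi> (y - ys))" if "dist y ys < d" for y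
  proof (rule power2_le_imp_le)
    show "(norm (\<Phi> (G y - ys)))\<^sup>2 \<le> (q * norm (\<Phi> (y - ys)))\<^sup>2"
      using \<epsilon>[OF chart that]
      by (simp add: q(3) G_def sform_same sum_negf norm_power2_vec[symmetric] power_mult_distrib algebra_simps)
  qed (simp add: q)
  \<comment> \<open>Both claims go through one induction: the next contraction needs the current
    iterate to be close, and closeness follows from the contraction so far.\<close>
  have iter: "norm (\<Phi> ((G ^^ k) y - ys)) \<le> q ^ k * norm (\<Phi> (y - ys)) \<and> dist ((G ^^ k) y) ys < \<rho>"
    if \<rho>: "\<rho> > 0" "\<rho> \<le> d" and y: "dist y ys < \<kappa> * \<rho> / K" for \<rho> y k
  proof -
    have small: "K * norm (y - ys) < \<kappa> * \<rho>"
      using y K(1) by (simp add: dist_norm pos_less_divide_eq mult.commute)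
    have *: "dist x ys < \<rho>" if "norm (\<Phi> (x - ys)) \<le> q ^ k * norm (\<Phi> (y - ys))" for x k
    proof -
      have "\<kappa> * norm (x - ys) \<le> q ^ k * norm (\<Phi> (y - ys))"
        using \<kappa>(2) that order.trans by blast
      also have "\<dots> \<le> 1 * norm (\<Phi> (y - ys))"
        using q by (intro mult_right_mono power_le_one) auto
      also have "\<dots> < \<kappa> * \<rho>"
        using small K(2)[of "y - ys"] by simp
      finally show ?thesis
        using \<kappa>(1) by (simp add: dist_norm)
    qed
    show ?thesis
    proof (induction k)
      case 0
      show ?case
        using *[of y 0] by simp
    next
      case (Suc k)
      then have "norm (\<Phi> (G ((G ^^ k) y) - ys)) \<le> q * norm (\<Phi> ((G ^^ k) y - ys))"
        using \<rho> by (intro step) auto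
      also have "\<dots> \<le> q * (q ^ k * norm (\<Phi> (y - ys)))"
        using Suc q by (intro mult_left_mono) auto
      finally have "norm (\<Phi> ((G ^^ Suc k) y - ys)) \<le> q ^ Suc k * norm (\<Phi> (y - ys))"
        by simp
      then show ?case
        using * by blast
    qed
  qed
  have "map_stable G ys"
    unfolding map_stable_def
  proof (intro allI impI)
    fix e :: real assume "e > 0"
    then have "\<kappa> * min e d / K > 0"
      using \<kappa>(1) K(1) \<open>d > 0\<close> by simp
    moreover have "dist ((G ^^ k) y) ys < e" if "dist y ys < \<kappa> * min e d / K" for y k
      using iter[OF _ _ that, of k] \<open>e > 0\<close> \<open>d > 0\<close> by simp
    ultimately show "\<exists>\<delta>>0. \<forall>y0. dist y0 ys < \<delta> \<longrightarrow> (\<forall>k. dist ((G ^^ k) y0) ys < e)"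
      by blast
  qed
  moreover have "map_attractive G ys"
    unfolding map_attractive_def
  proof (intro exI[of _ "\<kappa> * d / K"] conjI allI impI)
    show "\<kappa> * d / K > 0"
      using \<kappa>(1) K(1) \<open>d > 0\<close> by simp
    fix y assume y: "dist y ys < \<kappa> * d / K"
    have "(\<lambda>k. q ^ k * norm (\<Phi> (y - ys)) / \<kappa>) \<longlonglongrightarrow> 0"
      using tendsto_mult_left_zero[OF LIMSEQ_realpow_zero[OF q(1,2)], of "norm (\<Phi> (y - ys)) / \<kappa>"] by simp
    then have "(\<lambda>k. (G ^^ k) y - ys) \<longlonglongrightarrow> 0"
    proof (rule Lim_null_comparison[OF always_eventually, rotated])
      show "\<forall>k. norm ((G ^^ k) y - ys) \<le> q ^ k * norm (\<Phi> (y - ys)) / \<kappa>"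
      proof
        fix k
        have "\<kappa> * norm ((G ^^ k) y - ys) \<le> q ^ k * norm (\<Phi> (y - ys))"
          using iter[OF \<open>d > 0\<close> order.refl y, of k] \<kappa>(2)[of "(G ^^ k) y - ys"] by linarith
        then show "norm ((G ^^ k) y - ys) \<le> q ^ k * norm (\<Phi> (y - ys)) / \<kappa>"
          using \<kappa>(1) by (simp add: pos_le_divide_eq mult.commute)
      qed
    qed
    then show "(\<lambda>k. (G ^^ k) y) \<longlonglongrightarrow> ys"
      by (rule LIM_zero_cancel)
  qed
  ultimately show ?thesis
    unfolding map_asymptotically_stable_equilibrium_def map_equilibrium_def G_def[abs_def]
    by (simp add: eq)
qed

text \<open>Stability would confine an orbit with V > 0 to the chart, where V is bounded. But V
  grows at least by the factor \<gamma> > 1 in each step there. Without attractivity to contradict,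
  monotonicity of V alone would not suffice.\<close>

lemma map_unstable_if_expanding:
  fixes f :: "real^'n \<Rightarrow> real^'n"
  assumes diff: "f differentiable (at ys)" and eq: "f ys = 0" and "\<sigma> > 0"
    and \<mu>: "\<mu> \<in> complex_spectrum (jacobian f (at ys))" "cmod (1 + \<sigma> * \<mu>) > 1"
  shows "\<not> map_stable (\<lambda>y. y + \<sigma> *\<^sub>R f y) ys"
proof
  define G where "G y = y + \<sigma> *\<^sub>R f y" for y
  assume stable: "map_stable (\<lambda>y. y + \<sigma> *\<^sub>R f y) ys"
  obtain l :: "'n \<Rightarrow> complex" where l: "range l = complex_spectrum (jacobian f (at ys))" and
    ex: "\<And>\<epsilon>. \<epsilon> > 0 \<Longrightarrow> \<exists>\<Phi> d. near_diagonal_chart f ys l \<epsilon> \<Phi> d"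
    using local_normal_form[OF diff eq] by blast
  define s :: "'n \<Rightarrow> real" where "s i = (if cmod (1 + \<sigma> * l i) > 1 then 1 else -1)" for i
  have s: "\<bar>s i\<bar> = 1" for i
    by (simp add: s_def)
  define P where "P = {i. cmod (1 + \<sigma> * l i) > 1}"
  have "P \<noteq> {}"
    using \<mu> l by (force simp: P_def)
  define a where "a = Min ((\<lambda>i. (cmod (1 + \<sigma> * l i))\<^sup>2) ` P)"
  have "a > 1"
    using \<open>P \<noteq> {}\<close> by (auto simp: a_def P_def one_less_power)
  have a: "a \<le> (cmod (1 + \<sigma> * l i))\<^sup>2" if "cmod (1 + \<sigma> * l i) > 1" for i
    using that by (auto simp: a_def P_def intro: Min_le)
  \<comment> \<open>\<open>\<gamma>\<close> lies strictly between the squared moduli at most \<open>1\<close> and those above \<open>1\<close>, so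
    \<open>sform s\<close> grows by the factor \<open>\<gamma>\<close> even if there are multipliers on the unit circle.\<close>
  define \<gamma> where "\<gamma> = (1 + a) / 2"
  define c where "c = (a - 1) / 4"
  have "c > 0" "\<gamma> > 1"
    using \<open>a > 1\<close> by (auto simp: c_def \<gamma>_def)
  have "2 * c \<le> s i * ((cmod (1 + \<sigma> * l i))\<^sup>2 - \<gamma>)" for i
  proof (cases "cmod (1 + \<sigma> * l i) > 1")
    case True
    then show ?thesis
      using a[of i] by (simp add: s_def c_def \<gamma>_def field_simps)
  next
    case False
    then have "(cmod (1 + \<sigma> * l i))\<^sup>2 \<le> 1"
      by (simp add: power_le_one)
    with False show ?thesis
      by (simp add: s_def c_def \<gamma>_def field_simps)
  qed
  then have "\<exists>\<epsilon>0>0. \<forall>\<epsilon> \<Phi> d y. 0 < \<epsilon> \<and> \<epsilon> \<le> \<epsilon>0 \<and> near_diagonal_chart f ys l \<epsilon> \<Phi> d \<and> dist y ys < d \<longrightarrow>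
       \<gamma> * sform s (\<Phi> (y - ys)) (\<Phi> (y - ys)) + c * (norm (\<Phi> (y - ys)))\<^sup>2 \<le>
       sform s (\<Phi> (y + \<sigma> *\<^sub>R f y - ys)) (\<Phi> (y + \<sigma> *\<^sub>R f y - ys))"
    by (rule sform_growth_along_euler_step[OF \<open>\<sigma> > 0\<close> \<open>c > 0\<close> s])
  then obtain \<epsilon>0 where "\<epsilon>0 > 0" and \<epsilon>0: "\<And>\<epsilon> \<Phi> d y. 0 < \<epsilon> \<Longrightarrow> \<epsilon> \<le> \<epsilon>0 \<Longrightarrow>
       near_diagonal_chart f ys l \<epsilon> \<Phi> d \<Longrightarrow> dist y ys < d \<Longrightarrow>
       \<gamma> * sform s (\<Phi> (y - ys)) (\<Phi> (y - ys)) + c * (norm (\<Phi> (y - ys)))\<^sup>2 \<le>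
       sform s (\<Phi> (y + \<sigma> *\<^sub>R f y - ys)) (\<Phi> (y + \<sigma> *\<^sub>R f y - ys))"
    by blast
  \<comment> \<open>By the triangle inequality, multipliers differing by |1 + \<sigma> * \<mu>| - 1
    in modulus belong to eigenvalues at least this quantity over \<sigma> apart. As \<sigma> is
    real, the conjugate of \<mu> obeys the same bound.\<close>
  define g where "g = (cmod (1 + \<sigma> * \<mu>) - 1) / \<sigma>"
  have "g > 0"
    using \<mu>(2) \<open>\<sigma> > 0\<close> by (simp add: g_def)
  have gap: "g \<le> cmod (\<nu> - l i)" if "s i = -1" "cmod (1 + \<sigma> * \<nu>) = cmod (1 + \<sigma> * \<mu>)" for i and \<nu> :: complex
  proof -
    have "cmod (1 + \<sigma> * \<nu>) - cmod (1 + \<sigma> * l i) \<le> cmod ((1 + \<sigma> * \<nu>) - (1 + \<sigma> * l i))"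
      by (rule norm_triangle_ineq2)
    also have "(1 + \<sigma> * \<nu>) - (1 + \<sigma> * l i) = of_real \<sigma> * (\<nu> - l i)"
      by (simp add: algebra_simps)
    also have "cmod \<dots> = \<sigma> * cmod (\<nu> - l i)"
      using \<open>\<sigma> > 0\<close> by (simp add: norm_mult)
    finally have "cmod (1 + \<sigma> * \<nu>) - cmod (1 + \<sigma> * l i) \<le> \<sigma> * cmod (\<nu> - l i)" .
    moreover have "cmod (1 + \<sigma> * l i) \<le> 1"
      using that(1) by (auto simp: s_def split: if_splits)
    ultimately show ?thesis
      using that(2) \<open>\<sigma> > 0\<close> by (simp add: g_def pos_divide_le_eq mult.commute)
  qed
  have cnj: "cmod (1 + \<sigma> * cnj \<mu>) = cmod (1 + \<sigma> * \<mu>)"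
    by (metis complex_cnj_add complex_cnj_complex_of_real complex_cnj_mult complex_cnj_one complex_mod_cnj)
  define \<epsilon> where "\<epsilon> = min \<epsilon>0 (g / 2)"
  have \<epsilon>: "\<epsilon> > 0" "\<epsilon> \<le> \<epsilon>0" "2 * \<epsilon> \<le> g"
    using \<open>\<epsilon>0 > 0\<close> \<open>g > 0\<close> by (auto simp: \<epsilon>_def)
  obtain \<Phi> d where chart: "near_diagonal_chart f ys l \<epsilon> \<Phi> d"
    using ex[OF \<open>\<epsilon> > 0\<close>] by blast
  then have lin: "linear \<Phi>" and "d > 0" and
    pos: "\<And>s \<mu> g. \<mu> \<in> complex_spectrum (jacobian f (at ys)) \<and> 2 * \<epsilon> \<le> g \<and>
          (\<forall>i. \<bar>s i\<bar> = 1 \<and> (s i = -1 \<longrightarrow> cmod (\<mu> - l i) \<ge> g \<and> cmod (cnj \<mu> - l i) \<ge> g)) \<Longrightarrow>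
          (\<exists>x. sform s (\<Phi> x) (\<Phi> x) > 0)"
    unfolding near_diagonal_chart_def by blast+
  obtain x where x: "sform s (\<Phi> x) (\<Phi> x) > 0"
    using pos[of \<mu> g s] \<mu>(1) \<epsilon>(3) s gap cnj by blast
  obtain K where K: "K > 0" "\<And>x. norm (\<Phi> x) \<le> K * norm x"
    using linear_bounded_pos[OF lin] by blast
  obtain \<delta> where \<delta>: "\<delta> > 0" "\<And>y k. dist y ys < \<delta> \<Longrightarrow> dist ((G ^^ k) y) ys < d"
    using stable \<open>d > 0\<close> unfolding map_stable_def G_def[abs_def] by meson
  obtain b where b: "b > 0" "norm (b *\<^sub>R x) < \<delta>"
    using ex_small_scaleR[OF \<open>\<delta> > 0\<close>] by blast
  define y where "y = ys + b *\<^sub>R x"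
  have near: "dist ((G ^^ k) y) ys < d" for k
    using b(2) by (intro \<delta>(2)) (simp add: y_def dist_norm)
  define V where "V k = sform s (\<Phi> ((G ^^ k) y - ys)) (\<Phi> ((G ^^ k) y - ys))" for k
  have "V 0 > 0"
    using x b(1) by (simp add: V_def y_def linear_scale[OF lin] sform_scaleR)
  have growth: "\<gamma> * V k \<le> V (Suc k)" for k
    using \<epsilon>0[OF \<epsilon>(1,2) chart near[of k]] \<open>c > 0\<close> unfolding V_def
    by (simp add: G_def) (smt (verit) mult_nonneg_nonneg zero_le_power2)
  have V: "\<gamma> ^ k * V 0 \<le> V k" for k
  proof (induction k)
    case (Suc k)
    then have "\<gamma> * (\<gamma> ^ k * V 0) \<le> \<gamma> * V k"
      using \<open>\<gamma> > 1\<close> by (intro mult_left_mono) auto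
    then show ?case
      using growth[of k] by simp
  qed simp
  have bound: "V k \<le> (K * d)\<^sup>2" for k
  proof -
    have "V k \<le> norm (\<Phi> ((G ^^ k) y - ys)) * norm (\<Phi> ((G ^^ k) y - ys))"
      using abs_sform_le[of s, OF s] unfolding V_def by (meson abs_le_D1)
    also have "\<dots> \<le> (K * d) * (K * d)"
    proof -
      have "norm (\<Phi> ((G ^^ k) y - ys)) \<le> K * d"
        using K(1) near[of k] by (intro order.trans[OF K(2)] mult_left_mono) (auto simp: dist_norm)
      then show ?thesis
        using K(1) \<open>d > 0\<close> by (intro mult_mono) auto
    qed
    finally show ?thesis
      by (simp add: power2_eq_square)
  qed
  obtain k where "(K * d)\<^sup>2 / V 0 < \<gamma> ^ k"
    using real_arch_pow[OF \<open>\<gamma> > 1\<close>] by blast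
  then have "(K * d)\<^sup>2 < \<gamma> ^ k * V 0"
    using \<open>V 0 > 0\<close> by (simp add: pos_divide_less_eq)
  then show False
    using V[of k] bound[of k] by linarith
qed

section \<open>Local existence of solutions\<close>

text \<open>Picard iteration in the space of bounded continuous functions with values in a unit ball
  around y0. Continuity of the Jacobian enters through its boundedness on this ball, which makes f
  Lipschitz there.\<close>

lemma local_existence:
  fixes f :: "real^'n \<Rightarrow> real^'n"
  assumes C1: "C1_map f"
  obtains T y where "T > 0" "ode_solution_on f {0..<T} y" "y 0 = y0"
proof -
  have der: "(f has_derivative (\<lambda>h. jacobian f (at x) *v h)) (at x)" for x
    using C1 by (simp add: C1_map_def differentiable_on_def jacobian_works[symmetric])
  have contf: "continuous_on S f" for S
    by (intro continuous_at_imp_continuous_on ballI has_derivative_continuous[OF der])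
  define C where "C = cball y0 1"
  have "compact ((\<lambda>x. jacobian f (at x)) ` C)"
    using C1 unfolding C1_map_def C_def
    by (intro compact_continuous_image compact_cball) (auto elim: continuous_on_subset)
  from compact_imp_bounded[OF this] obtain D where D: "D > 0" "\<And>x. x \<in> C \<Longrightarrow> norm (jacobian f (at x)) \<le> D"
    unfolding bounded_pos by auto
  \<comment> \<open>A crude bound on the operator norm of a matrix whose entries are at most D in
    modulus.\<close>
  define L where "L = real CARD('n) * real CARD('n) * D"
  have "L > 0"
    using D by (simp add: L_def)
  have lip: "norm (f x - f y) \<le> L * norm (x - y)" if "x \<in> C" "y \<in> C" for x y
  proof (rule differentiable_bound[of C f "\<lambda>x h. jacobian f (at x) *v h"])
    show "(f has_derivative (\<lambda>h. jacobian f (at x) *v h)) (at x within C)" for x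
      by (rule has_derivative_at_withinI[OF der])
    show "onorm (\<lambda>h. jacobian f (at x) *v h) \<le> L" if "x \<in> C" for x
      unfolding L_def
    proof (rule onorm_le_matrix_component)
      fix i j
      have "\<bar>jacobian f (at x) $ i $ j\<bar> \<le> norm (jacobian f (at x) $ i)"
        by (rule component_le_norm_cart)
      also have "\<dots> \<le> norm (jacobian f (at x))"
        by (rule Finite_Cartesian_Product.norm_nth_le)
      finally show "\<bar>jacobian f (at x) $ i $ j\<bar> \<le> D"
        using D(2)[OF that] by linarith
    qed
  qed (use that in \<open>auto simp: C_def\<close>)
  have "compact (f ` C)"
    using contf by (intro compact_continuous_image) (auto simp: C_def)
  from compact_imp_bounded[OF this] obtain B where B: "B > 0" "\<And>x. x \<in> C \<Longrightarrow> norm (f x) \<le> B"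
    unfolding bounded_pos by auto
  \<comment> \<open>The first bound keeps the iterates in C, the second makes the iteration contract
    by 1 / 2.\<close>
  define T where "T = min (1 / B) (1 / (2 * L))"
  have T: "T > 0" "B * T \<le> 1" "L * T \<le> 1 / 2"
    using B(1) \<open>L > 0\<close> by (auto simp: T_def min_def field_simps)
  \<comment> \<open>The function space lives on the whole real line; clamping the time to [0, T]
    extends the Picard integral to it.\<close>
  define cl where "cl t = max 0 (min T t)" for t
  have cl: "0 \<le> cl t" "cl t \<le> T" for t
    using T(1) by (auto simp: cl_def)
  define S where "S = PiC UNIV (\<lambda>_::real. C)"
  have S: "apply_bcontfun u t \<in> C" if "u \<in> S" for u t
    using that by (auto simp: S_def mem_PiC_iff)
  define g where "g u t = y0 + integral {0..cl t} (\<lambda>r. f (apply_bcontfun u r))" for u t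
  have contu: "continuous_on X (\<lambda>r. f (apply_bcontfun u r))" for X u
    by (intro continuous_on_compose2[OF contf]) auto
  have gC: "g u t \<in> C" if "u \<in> S" for u t
  proof -
    have "norm (integral {0..cl t} (\<lambda>r. f (apply_bcontfun u r))) \<le> B * (cl t - 0)"
      using contu cl B(2) S[OF that] by (intro integral_bound) auto
    also have "\<dots> \<le> B * T"
      using cl B(1) by (intro mult_left_mono) auto
    also have "\<dots> \<le> 1"
      by (rule T)
    finally show ?thesis
      by (simp add: g_def C_def dist_norm)
  qed
  have gcont: "continuous_on UNIV (g u)" for u
  proof -
    have "continuous_on {0..T} (\<lambda>x. integral {0..x} (\<lambda>r. f (apply_bcontfun u r)))"
      by (intro indefinite_integral_continuous_1 integrable_continuous_interval contu)
    moreover have "continuous_on UNIV cl"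
      unfolding cl_def by (intro continuous_intros)
    moreover have "cl ` UNIV \<subseteq> {0..T}"
      using cl by auto
    ultimately have "continuous_on UNIV (\<lambda>t. integral {0..cl t} (\<lambda>r. f (apply_bcontfun u r)))"
      by (rule continuous_on_compose2)
    then show ?thesis
      unfolding g_def by (intro continuous_on_add continuous_on_const)
  qed
  define F where "F u = Bcontfun (g u)" for u
  have F: "apply_bcontfun (F u) = g u" if "u \<in> S" for u
  proof -
    have "range (g u) \<subseteq> C"
      using gC[OF that] by auto
    then have "bounded (range (g u))"
      unfolding C_def by (rule bounded_subset[OF bounded_cball])
    then show ?thesis
      using gcont by (simp add: F_def Bcontfun_inverse bcontfun_def)
  qed
  have "\<exists>!u\<in>S. F u = u"
  proof (rule Banach_fix[where c = "1 / 2"])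
    show "complete S"
      unfolding complete_eq_closed S_def C_def by (intro closed_PiC) auto
    show "S \<noteq> {}"
    proof -
      have "const_bcontfun y0 \<in> S"
        by (auto simp: S_def mem_PiC_iff C_def const_bcontfun.rep_eq)
      then show ?thesis
        by blast
    qed
    show "F ` S \<subseteq> S"
      using gC by (auto simp: S_def mem_PiC_iff F[unfolded S_def])
    show "dist (F u) (F v) \<le> 1 / 2 * dist u v" if u: "u \<in> S" and v: "v \<in> S" for u v
    proof (rule dist_bound)
      fix t
      have "g u t - g v t = integral {0..cl t} (\<lambda>r. f (apply_bcontfun u r) - f (apply_bcontfun v r))"
        unfolding g_def by (subst integral_diff) (auto intro!: integrable_continuous_interval contu)
      also have "norm \<dots> \<le> (L * dist u v) * (cl t - 0)"
      proof (rule integral_bound)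
        show "norm (f (apply_bcontfun u r) - f (apply_bcontfun v r)) \<le> L * dist u v" for r
        proof -
          have "norm (f (apply_bcontfun u r) - f (apply_bcontfun v r)) \<le> L * dist (apply_bcontfun u r) (apply_bcontfun v r)"
            unfolding dist_norm by (intro lip S u v)
          also have "\<dots> \<le> L * dist u v"
            using \<open>L > 0\<close> by (intro mult_left_mono dist_bounded) auto
          finally show ?thesis .
        qed
      qed (auto intro: cl continuous_on_diff contu)
      also have "\<dots> \<le> (L * dist u v) * T"
        using cl \<open>L > 0\<close> by (intro mult_left_mono) auto
      also have "\<dots> = (L * T) * dist u v"
        by simp
      also have "\<dots> \<le> 1 / 2 * dist u v"
        using T by (intro mult_right_mono) auto
      finally show "dist (apply_bcontfun (F u) t) (apply_bcontfun (F v) t) \<le> 1 / 2 * dist u v"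
        by (simp add: F u v dist_norm)
    qed
  qed auto
  then obtain u where u: "u \<in> S" "F u = u"
    by blast
  have eq: "apply_bcontfun u t = y0 + integral {0..t} (\<lambda>r. f (apply_bcontfun u r))" if "t \<in> {0..T}" for t
  proof -
    have "apply_bcontfun u t = g u t"
      using F[OF u(1)] u(2) by simp
    then show ?thesis
      using that by (simp add: g_def cl_def)
  qed
  have "(apply_bcontfun u has_vector_derivative f (apply_bcontfun u t)) (at t within {0..<T})" if "t \<in> {0..<T}" for t
  proof -
    have "((\<lambda>x. integral {0..x} (\<lambda>r. f (apply_bcontfun u r))) has_vector_derivative f (apply_bcontfun u t)) (at t within {0..T})"
      using that by (intro integral_has_vector_derivative contu) auto
    then have "((\<lambda>x. y0 + integral {0..x} (\<lambda>r. f (apply_bcontfun u r))) has_vector_derivative f (apply_bcontfun u t)) (at t within {0..T})"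
      by (auto intro!: derivative_eq_intros)
    then have "(apply_bcontfun u has_vector_derivative f (apply_bcontfun u t)) (at t within {0..T})"
      using that eq by (intro has_vector_derivative_transform[of t "{0..T}" "apply_bcontfun u"]) auto
    then show ?thesis
      by (rule has_vector_derivative_within_subset) auto
  qed
  then have "ode_solution_on f {0..<T} (apply_bcontfun u)"
    by (simp add: ode_solution_on_def)
  moreover have "apply_bcontfun u 0 = y0"
    using eq[of 0] T by simp
  ultimately show thesis
    using that T(1) by blast
qed

section \<open>Conservation laws as pointwise identities\<close>

lemma bounded_linear_component_sum: "bounded_linear (component_sum :: real^'n \<Rightarrow> real)"
  unfolding component_sum_def[abs_def]
  by (intro bounded_linear_sum bounded_linear_vec_nth)

text \<open>Both laws are covered by the choice of r. At time 0 of a solution through y0 the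
  component sum has two one-sided derivatives, one from the equation and one from the law, and these
  agree.\<close>

lemma component_sum_vector_field:
  fixes f :: "real^'n \<Rightarrow> real^'n"
  assumes C1: "C1_map f"
    and law: "\<And>T y t. T > 0 \<Longrightarrow> ode_solution_on f {0..<T} y \<Longrightarrow> t \<in> {0..<T} \<Longrightarrow>
      ((\<lambda>s. component_sum (y s)) has_real_derivative r (component_sum (y t))) (at t within {0..<T})"
  shows "component_sum (f y0) = r (component_sum y0)"
proof -
  obtain T y where T: "T > 0" and sol: "ode_solution_on f {0..<T} y" and y0: "y 0 = y0"
    using local_existence[OF C1] by blast
  have "(y has_vector_derivative f y0) (at 0 within {0..<T})"
    using sol T y0 by (auto simp: ode_solution_on_def)
  then have "((\<lambda>s. component_sum (y s)) has_vector_derivative component_sum (f y0)) (at 0 within {0..<T})"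
    by (rule bounded_linear.has_vector_derivative[OF bounded_linear_component_sum])
  moreover have "((\<lambda>s. component_sum (y s)) has_vector_derivative r (component_sum y0)) (at 0 within {0..<T})"
    using law[OF T sol, of 0] T y0 by (simp add: has_real_derivative_iff_has_vector_derivative)
  moreover have "{0..T / 2} \<subseteq> {0..<T}"
    using T by auto
  ultimately show ?thesis
    using T by (intro vector_derivative_unique_within_closed_interval[of 0 "T / 2" 0])
      (auto intro: has_vector_derivative_within_subset)
qed

section \<open>Consistency of the scheme\<close>

text \<open>Each step multiplies the distance from a / b by r = 1 - \<sigma> * b. Convergence comes
  from r < 1; r > 0 rules out oscillation around the limit and thus gives monotonicity.\<close>

lemma affine_recursion_converges:
  fixes p :: "nat \<Rightarrow> real"
  assumes rec: "\<And>k. p (Suc k) = p k + \<sigma> * (a - b * p k)" and \<sigma>: "0 < \<sigma> * b" "\<sigma> * b < 1"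
  shows "monoseq p \<and> p \<longlonglongrightarrow> a / b"
proof -
  have "b \<noteq> 0"
    using \<sigma> by auto
  define r where "r = 1 - \<sigma> * b"
  have r: "0 < r" "r < 1"
    using \<sigma> by (auto simp: r_def)
  have p: "p k = a / b + r ^ k * (p 0 - a / b)" for k
  proof (induction k)
    case (Suc k)
    have "p (Suc k) = a / b + r * (p k - a / b)"
      using \<open>b \<noteq> 0\<close> by (simp add: rec r_def field_simps)
    then show ?case
      by (simp add: Suc)
  qed simp
  have dec: "r ^ Suc k \<le> r ^ k" for k
    using r by (intro power_decreasing) auto
  have "p (Suc k) \<le> p k" if "p 0 \<ge> a / b" for k
    using mult_right_mono[OF dec[of k], of "p 0 - a / b"] that p[of k] p[of "Suc k"] by simp
  moreover have "p k \<le> p (Suc k)" if "p 0 \<le> a / b" for k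
    using mult_right_mono_neg[OF dec[of k], of "p 0 - a / b"] that p[of k] p[of "Suc k"] by simp
  ultimately have "monoseq p"
    unfolding monoseq_Suc by (meson linear)
  moreover have "(\<lambda>k. a / b + r ^ k * (p 0 - a / b)) \<longlonglongrightarrow> a / b + 0"
    using r by (intro tendsto_add tendsto_const tendsto_mult_left_zero LIMSEQ_realpow_zero) auto
  then have "p \<longlonglongrightarrow> a / b"
    by (simp flip: p)
  ultimately show ?thesis
    by simp
qed

section \<open>The four consistency statements\<close>

lemma component_sum_nsfd_map:
  "component_sum (nsfd_map f m h y) = component_sum y + h / (1 + m * h) * component_sum (f y)"
proof -
  have "linear (component_sum :: real^'a \<Rightarrow> real)"
    by (rule bounded_linear.linear[OF bounded_linear_component_sum])
  then show ?thesis
    by (simp add: nsfd_map_def linear_add linear_scale)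
qed

lemma nsfd_map_eq: "nsfd_map f m h = (\<lambda>y. y + (h / (1 + m * h)) *\<^sub>R f y)"
  by (simp add: nsfd_map_def fun_eq_iff)

text \<open>The step y + \<sigma> * f y equals (1 - \<sigma> * m) * y + \<sigma> * (f y + m * y), a
  sum of nonnegative vectors because \<sigma> * m \<le> 1 and m \<ge> \<alpha>.\<close>

lemma consistent_positivity_nsfd:
  fixes f :: "real^'n \<Rightarrow> real^'n"
  assumes f: "\<And>y. 0 \<le> y \<Longrightarrow> 0 \<le> f y + \<alpha> *\<^sub>R y" and m: "m \<ge> max \<alpha> 0" and "h > 0"
  shows "consistent_positivity f m h"
  unfolding consistent_positivity_def
proof (intro allI impI; elim conjE)
  fix y :: "nat \<Rightarrow> real^'n" and k
  assume sol: "nsfd_solution f m h y" and y0: "0 \<le> y 0"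
  define \<sigma> where "\<sigma> = h / (1 + m * h)"
  have "1 + m * h > 0"
    using m \<open>h > 0\<close> by (simp add: add_pos_nonneg)
  then have \<sigma>: "\<sigma> \<ge> 0" "\<sigma> * m \<le> 1"
    using \<open>h > 0\<close> by (auto simp: \<sigma>_def divide_simps)
  have step: "y (Suc k) = y k + \<sigma> *\<^sub>R f (y k)" for k
    using sol \<open>h > 0\<close> \<open>1 + m * h > 0\<close> by (simp add: nsfd_solution_iff_map nsfd_map_def \<sigma>_def)
  show "0 \<le> y k"
  proof (induction k)
    case (Suc k)
    have "0 \<le> y (Suc k) $ i" for i
    proof -
      have yi: "0 \<le> y k $ i"
        using Suc by (simp add: less_eq_vec_def)
      have "0 \<le> f (y k) $ i + \<alpha> * y k $ i"
        using f[OF Suc] by (simp add: less_eq_vec_def)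
      also have "\<dots> \<le> f (y k) $ i + m * y k $ i"
        using m yi by (intro add_left_mono mult_right_mono) auto
      finally have "0 \<le> \<sigma> * (f (y k) $ i + m * y k $ i)"
        using \<sigma> by simp
      moreover have "\<sigma> * m * y k $ i \<le> 1 * y k $ i"
        using \<sigma> yi by (intro mult_right_mono)
      ultimately show ?thesis
        by (simp add: step algebra_simps)
    qed
    then show ?case
      by (simp add: less_eq_vec_def)
  qed (rule y0)
qed

lemma finite_complex_spectrum: "finite (complex_spectrum A)" and complex_spectrum_nonempty: "complex_spectrum A \<noteq> {}"
  for A :: "real^'n^'n"
proof -
  obtain l :: "'n \<Rightarrow> complex" where "range l = complex_spectrum A"
    by (rule almost_diagonalization[of "map_matrix complex_of_real A"]) (auto simp: complex_spectrum_eq)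
  then show "finite (complex_spectrum A)" "complex_spectrum A \<noteq> {}"
    by (metis finite finite_imageI) (metis \<open>range l = _\<close> empty_is_image UNIV_not_empty)
qed

text \<open>Everything is decided by the sign of 2 Re \<mu> + \<sigma> * |\<mu>|^2. At a stable
  equilibrium m bounds \<sigma> so that it is negative for every \<mu>; at an unstable one
  hyperbolicity yields some \<mu> with Re \<mu> > 0, for which it is positive.\<close>

lemma consistent_local_asymptotic_stability_nsfd:
  fixes f :: "real^'n \<Rightarrow> real^'n"
  assumes C1: "C1_map f" and fin: "finite {ys. ode_equilibrium f ys}"
    and hyp: "\<And>ys. ode_equilibrium f ys \<Longrightarrow> hyperbolic f ys"
    and ne: "{ys. ode_asymptotically_stable_equilibrium f ys} \<noteq> {}"
    and m: "m \<ge> m_S f" and "h > 0"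
  shows "consistent_local_asymptotic_stability f m h"
proof -
  have diff: "f differentiable (at x)" for x
    using C1 by (simp add: C1_map_def differentiable_on_def)
  have equi: "ode_equilibrium f ys" if "ode_asymptotically_stable_equilibrium f ys" for ys
    using that by (simp add: ode_asymptotically_stable_equilibrium_def)
  have "{ys. ode_asymptotically_stable_equilibrium f ys} \<subseteq> {ys. ode_equilibrium f ys}"
    using equi by auto
  \<comment> \<open>\<open>Max\<close> in \<open>m_S\<close> is an upper bound only over a finite
    set.\<close>
  then have "finite (stable_spectra f)"
    unfolding stable_spectra_def using fin finite_complex_spectrum by (auto intro: finite_subset)
  then have m_ge: "m \<ge> - ((cmod \<mu>)\<^sup>2 / (2 * Re \<mu>))" if "\<mu> \<in> stable_spectra f" for \<mu>
    using that m unfolding m_S_def by (meson Max_ge finite_imageI image_eqI order.trans)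
  have neg: "Re \<mu> < 0" if "\<mu> \<in> stable_spectra f" for \<mu>
    using that asymptotically_stable_hyperbolic_imp_spectrum_negative[OF diff] hyp equi
    unfolding stable_spectra_def by blast
  \<comment> \<open>Every eigenvalue here contributes a positive number to the maximum, so m > 0;
    this gives \<sigma> > 0 and \<sigma> * m < 1 for every step size.\<close>
  have "stable_spectra f \<noteq> {}"
    using ne complex_spectrum_nonempty unfolding stable_spectra_def by blast
  then obtain \<mu>0 where \<mu>0: "\<mu>0 \<in> stable_spectra f"
    by blast
  have "(cmod \<mu>0)\<^sup>2 > 0"
    using neg[OF \<mu>0] by auto
  then have "- ((cmod \<mu>0)\<^sup>2 / (2 * Re \<mu>0)) > 0"
    using neg[OF \<mu>0] by (simp add: divide_pos_neg)
  then have "m > 0"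
    using m_ge[OF \<mu>0] by linarith
  define \<sigma> where "\<sigma> = h / (1 + m * h)"
  have "\<sigma> > 0"
    using \<open>m > 0\<close> \<open>h > 0\<close> by (simp add: \<sigma>_def add_pos_pos)
  have "\<sigma> * m < 1"
    using \<open>m > 0\<close> \<open>h > 0\<close> by (simp add: \<sigma>_def add_pos_pos pos_divide_less_eq algebra_simps)
  have map: "nsfd_map f m h = (\<lambda>y. y + \<sigma> *\<^sub>R f y)"
    by (simp add: nsfd_map_eq \<sigma>_def)
  have cmod_eq: "(cmod (1 + \<sigma> * \<mu>))\<^sup>2 = 1 + \<sigma> * (2 * Re \<mu> + \<sigma> * (cmod \<mu>)\<^sup>2)" for \<mu> :: complex
    unfolding cmod_power2 by (simp add: power2_eq_square algebra_simps)
  have "map_asymptotically_stable_equilibrium (nsfd_map f m h) ys"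
    if ys: "ode_asymptotically_stable_equilibrium f ys" for ys
    unfolding map
  proof (rule map_asymptotically_stable_if_contracting[OF diff _ \<open>\<sigma> > 0\<close>])
    show "f ys = 0"
      using equi[OF ys] by (simp add: ode_equilibrium_def)
    fix \<mu> assume "\<mu> \<in> complex_spectrum (jacobian f (at ys))"
    then have \<mu>: "\<mu> \<in> stable_spectra f"
      using ys by (auto simp: stable_spectra_def)
    have "(cmod \<mu>)\<^sup>2 \<le> m * (- 2 * Re \<mu>)"
      using m_ge[OF \<mu>] neg[OF \<mu>] by (simp add: divide_simps split: if_splits)
    then have "\<sigma> * (cmod \<mu>)\<^sup>2 \<le> \<sigma> * (m * (- 2 * Re \<mu>))"
      using \<open>\<sigma> > 0\<close> by (intro mult_left_mono) auto
    also have "\<dots> = (\<sigma> * m) * (- 2 * Re \<mu>)"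
      by simp
    \<comment> \<open>Strictness of \<sigma> * m < 1 admits the borderline value m =
      \<open>m_S f\<close>.\<close>
    also have "\<dots> < 1 * (- 2 * Re \<mu>)"
      using \<open>\<sigma> * m < 1\<close> neg[OF \<mu>] by (intro mult_strict_right_mono) auto
    finally have "\<sigma> * (2 * Re \<mu> + \<sigma> * (cmod \<mu>)\<^sup>2) < 0"
      using \<open>\<sigma> > 0\<close> by (intro mult_pos_neg) auto
    then have "(cmod (1 + \<sigma> * \<mu>))\<^sup>2 < 1\<^sup>2"
      by (simp add: cmod_eq)
    then show "cmod (1 + \<sigma> * \<mu>) < 1"
      by (rule power2_less_imp_less) simp
  qed
  moreover have "map_unstable_equilibrium (nsfd_map f m h) ys"
    if ys: "ode_unstable_equilibrium f ys" for ys
  proof -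
    have eq: "f ys = 0" and nstable: "\<not> ode_stable f ys"
      using ys by (auto simp: ode_unstable_equilibrium_def ode_equilibrium_def)
    obtain \<mu> where \<mu>: "\<mu> \<in> complex_spectrum (jacobian f (at ys))" "\<not> Re \<mu> < 0"
      using ode_stable_if_spectrum_negative[OF diff eq] nstable by blast
    then have "Re \<mu> > 0"
      using hyp[of ys] eq by (force simp: hyperbolic_def ode_equilibrium_def)
    then have "\<sigma> * (2 * Re \<mu> + \<sigma> * (cmod \<mu>)\<^sup>2) > 0"
      using \<open>\<sigma> > 0\<close> by (intro mult_pos_pos add_pos_nonneg) auto
    then have "1\<^sup>2 < (cmod (1 + \<sigma> * \<mu>))\<^sup>2"
      by (simp add: cmod_eq)
    then have "1 < cmod (1 + \<sigma> * \<mu>)"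
      by (rule power2_less_imp_less) simp
    then have "\<not> map_stable (nsfd_map f m h) ys"
      unfolding map by (rule map_unstable_if_expanding[OF diff eq \<open>\<sigma> > 0\<close> \<mu>(1)])
    then show ?thesis
      by (simp add: map_unstable_equilibrium_def map_equilibrium_def map eq)
  qed
  ultimately show ?thesis
    by (simp add: consistent_local_asymptotic_stability_def)
qed

lemma consistent_direct_conservation_nsfd:
  fixes f :: "real^'n \<Rightarrow> real^'n"
  assumes C1: "C1_map f" and law: "direct_conservation_law f" and h: "h \<noteq> 0" "1 + m * h \<noteq> 0"
  shows "consistent_direct_conservation f m h"
proof -
  have "component_sum (f y) = 0" for y
    by (rule component_sum_vector_field[OF C1, of "\<lambda>_. 0"])
      (use law in \<open>auto simp: direct_conservation_law_def\<close>)
  then show ?thesis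
    by (simp add: consistent_direct_conservation_def nsfd_solution_iff_map[OF h] component_sum_nsfd_map)
qed

text \<open>The bounds are put on the ratio h / (1 + m * h) rather than on h, because
  \<open>phi_E\<close> may be negative while its ratio times b lies in (0, 1).\<close>

lemma consistent_generalized_conservation_nsfd:
  fixes f :: "real^'n \<Rightarrow> real^'n"
  assumes C1: "C1_map f" and law: "generalized_conservation_law f a b" and h: "h \<noteq> 0" "1 + m * h \<noteq> 0"
    and \<sigma>: "0 < h / (1 + m * h) * b" "h / (1 + m * h) * b < 1"
  shows "consistent_generalized_conservation f a b m h"
proof -
  have "component_sum (f y) = a - b * component_sum y" for y
    by (rule component_sum_vector_field[OF C1, of "\<lambda>p. a - b * p"])
      (use law in \<open>auto simp: generalized_conservation_law_def\<close>)
  then show ?thesis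
    unfolding consistent_generalized_conservation_def nsfd_solution_iff_map[OF h]
    by (intro allI impI affine_recursion_converges[OF _ \<sigma>]) (simp add: component_sum_nsfd_map)
qed

text \<open>The map p / (1 - m * p) is inverse to h / (1 + m * h), so the effective step is
  \<open>phi_star\<close>. The recursion factor is then exp (- b * t), exactly the one by which the
  true component sum approaches a / b in time t.\<close>

lemma phi_E_ratio:
  assumes "b > 0" "t > 0" and ne: "1 - m * phi_star b t \<noteq> 0"
  shows "phi_E m b t \<noteq> 0" "1 + m * phi_E m b t \<noteq> 0"
    "phi_E m b t / (1 + m * phi_E m b t) * b = 1 - exp (- b * t)"
proof -
  define p where "p = phi_star b t"
  have "p > 0"
    using assms by (simp add: p_def phi_star_def)
  have E: "phi_E m b t = p / (1 - m * p)"
    by (simp add: phi_E_def p_def)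
  then show "phi_E m b t \<noteq> 0"
    using \<open>p > 0\<close> ne by (simp add: p_def)
  have 1: "1 + m * phi_E m b t = 1 / (1 - m * p)"
    using ne by (simp add: E p_def field_simps)
  then show "1 + m * phi_E m b t \<noteq> 0"
    using ne by (simp add: p_def)
  have "phi_E m b t / (1 + m * phi_E m b t) = p"
    unfolding 1 using ne by (simp add: E p_def)
  then show "phi_E m b t / (1 + m * phi_E m b t) * b = 1 - exp (- b * t)"
    using \<open>b > 0\<close> by (simp add: p_def phi_star_def)
qed

theorem theorem3p13:
  fixes f :: "real^'n \<Rightarrow> real^'n" and m :: real
  assumes "C1_map f"
  shows
    "(\<forall>\<phi> \<alpha>. denominator_function \<phi> \<and> (\<forall>y. 0 \<le> y \<longrightarrow> 0 \<le> f y + \<alpha> *\<^sub>R y) \<and> m \<ge> max \<alpha> 0 \<longrightarrow>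
        (\<forall>\<Delta>t>0. consistent_positivity f m (\<phi> \<Delta>t))) \<and>
     (\<forall>\<phi>. denominator_function \<phi> \<and>
        finite {ys. ode_equilibrium f ys} \<and>
        (\<forall>ys. ode_equilibrium f ys \<longrightarrow> hyperbolic f ys) \<and>
        {ys. ode_asymptotically_stable_equilibrium f ys} \<noteq> {} \<and>
        m \<ge> m_S f \<longrightarrow>
        (\<forall>\<Delta>t>0. consistent_local_asymptotic_stability f m (\<phi> \<Delta>t))) \<and>
     (\<forall>\<phi>. denominator_function \<phi> \<and> direct_conservation_law f \<longrightarrow>
        (\<forall>\<Delta>t>0. 1 + m * \<phi> \<Delta>t \<noteq> 0 \<longrightarrow> consistent_direct_conservation f m (\<phi> \<Delta>t))) \<and>
     (\<forall>a b. a > 0 \<and> b > 0 \<and> generalized_conservation_law f a b \<longrightarrow>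
        (\<forall>\<phi>. denominator_function \<phi> \<and> m \<ge> b \<longrightarrow>
           (\<forall>\<Delta>t>0. consistent_generalized_conservation f a b m (\<phi> \<Delta>t))) \<and>
        (\<forall>\<Delta>t>0. 1 - m * phi_star b \<Delta>t \<noteq> 0 \<longrightarrow>
           consistent_generalized_conservation f a b m (phi_E m b \<Delta>t)))"
proof -
  have pos: "\<phi> t > 0" if "denominator_function \<phi>" "t > 0" for \<phi> and t :: real
    using that by (simp add: denominator_function_def)
  have ratio: "0 < h / (1 + m * h) * b" "h / (1 + m * h) * b < 1" "1 + m * h \<noteq> 0"
    if "b > 0" "m \<ge> b" "h > 0" for b h
  proof -
    \<comment> \<open>Since b \<le> m, the quantity h * b is at most m * h and so stays below the
      denominator for every h > 0.\<close>
    have "h * b \<le> m * h"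
      using that by (simp add: mult.commute)
    then have "h * b < 1 + m * h"
      by simp
    moreover have "1 + m * h > 0"
      using that by (simp add: add_pos_pos)
    ultimately show "0 < h / (1 + m * h) * b" "h / (1 + m * h) * b < 1" "1 + m * h \<noteq> 0"
      using that by (auto simp: pos_divide_less_eq)
  qed
  show ?thesis
  proof (intro conjI allI impI; (elim conjE)?)
    fix \<phi> :: "real \<Rightarrow> real" and \<alpha> t :: real
    assume "denominator_function \<phi>" "t > 0" "\<forall>y. 0 \<le> y \<longrightarrow> 0 \<le> f y + \<alpha> *\<^sub>R y" "m \<ge> max \<alpha> 0"
    then show "consistent_positivity f m (\<phi> t)"
      using pos by (intro consistent_positivity_nsfd[of f \<alpha>]) auto
  next
    fix \<phi> :: "real \<Rightarrow> real" and t :: real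
    assume "denominator_function \<phi>" "t > 0" "finite {ys. ode_equilibrium f ys}"
      "\<forall>ys. ode_equilibrium f ys \<longrightarrow> hyperbolic f ys"
      "{ys. ode_asymptotically_stable_equilibrium f ys} \<noteq> {}" "m \<ge> m_S f"
    then show "consistent_local_asymptotic_stability f m (\<phi> t)"
      using assms pos by (intro consistent_local_asymptotic_stability_nsfd) auto
  next
    fix \<phi> :: "real \<Rightarrow> real" and t :: real
    assume "denominator_function \<phi>" "t > 0" "direct_conservation_law f" "1 + m * \<phi> t \<noteq> 0"
    then show "consistent_direct_conservation f m (\<phi> t)"
      using pos[of \<phi> t] by (intro consistent_direct_conservation_nsfd[OF assms]) auto
  next
    fix a b t :: real and \<phi> :: "real \<Rightarrow> real"
    assume "b > 0" "generalized_conservation_law f a b" "denominator_function \<phi>" "m \<ge> b" "t > 0"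
    then show "consistent_generalized_conservation f a b m (\<phi> t)"
      using pos[of \<phi> t] ratio[of b "\<phi> t"] by (intro consistent_generalized_conservation_nsfd[OF assms]) auto
  next
    fix a b t :: real
    assume b: "b > 0" and law: "generalized_conservation_law f a b" and t: "t > 0"
      and ne: "1 - m * phi_star b t \<noteq> 0"
    note E = phi_E_ratio[OF b t ne]
    show "consistent_generalized_conservation f a b m (phi_E m b t)"
      by (rule consistent_generalized_conservation_nsfd[OF assms law E(1,2)]; unfold E(3))
        (use b t in auto)
  qed
qed

end
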